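(* Let $d\ge 1$ be an integer and $m\neq 0$ a real number, and let $\mu_m$ be the Gaussian measure of mean zero on $\mathcal S'(\mathbb R^d)$ with covariance $(f,g)_m=\frac12\int_{\mathbb R^d} f\,(m^2-\Delta)^{-1/2}g\,d^dx$, $f,g\in\mathcal S(\mathbb R^d)$. Then for $\mu_m$-almost every $\phi\in\mathcal S'(\mathbb R^d)$ there is no non-empty open set $U\subset\mathbb R^d$ on which $\phi$ can be identified with a signed measure.
   Context: $\mathcal S(\mathbb R^d)$ is the nuclear space of real Schwartz functions and $\mathcal S'(\mathbb R^d)$ its topological dual (real tempered distributions). $\Delta$ is the Laplacian, and $(m^2-\Delta)^{-1/2}$ is the operator of multiplication of the Fourier transform by $(m^2+p^2)^{-1/2}$, where $p^2=|p|^2$. The Gaussian measure of mean zero with covariance $(\cdot,\cdot)_m$ is the unique probability measure $\mu_m$ on $\mathcal S'(\mathbb R^d)$ (with the $\sigma$-algebra generated by the evaluations $\phi\mapsto\phi(f)$, $f\in\mathcal S(\mathbb R^d)$) such that $\int e^{i\phi(f)}\,d\mu_m(\phi)=e^{-\frac12 (f,f)_m}$ for all $f\in\mathcal S(\mathbb R^d)$. A distribution $\phi\in\mathcal S'(\mathbb R^d)$ can be identified with a signed measure on an open set $U\subset\mathbb R^d$ if there are a (positive Borel) measure $\nu$ on $U$ and a $\nu$-integrable function $F$ such that $\phi(f)=\int_U fF\,d\nu$ for every $f\in\mathcal S(\mathbb R^d)$ supported in $U$. "For $\mu_m$-almost every $\phi$" means that the exceptional set is contained in a measurable set of $\mu_m$-measure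 zero. *)

theory Defs
  imports "HOL-Probability.Probability"
begin

definition partial_deriv :: "'d::finite \<Rightarrow> (real^'d \<Rightarrow> real) \<Rightarrow> real^'d \<Rightarrow> real" where
  "partial_deriv i f x = deriv (\<lambda>t. f (x + t *\<^sub>R axis i 1)) 0"

text \<open>Higher partial derivatives are indexed by lists of coordinates. Every multi-index derivative
  is of this form, and for smooth functions the order of the list is irrelevant.\<close>

fun partial_derivs :: "'d::finite list \<Rightarrow> (real^'d \<Rightarrow> real) \<Rightarrow> real^'d \<Rightarrow> real" where
  "partial_derivs [] f = f"
| "partial_derivs (i # js) f = partial_deriv i (partial_derivs js f)"

definition smooth :: "(real^'d::finite \<Rightarrow> real) \<Rightarrow> bool" where
  "smooth f \<longleftrightarrow> (\<forall>js. partial_derivs js f differentiable_on UNIV)"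

definition weighted_deriv ::
    "('d::finite \<Rightarrow> nat) \<Rightarrow> 'd list \<Rightarrow> (real^'d \<Rightarrow> real) \<Rightarrow> real^'d \<Rightarrow> real" where
  "weighted_deriv \<alpha> js f x = (\<Prod>i\<in>UNIV. (x $ i) ^ \<alpha> i) * partial_derivs js f x"

definition schwartz :: "(real^'d::finite \<Rightarrow> real) set" where
  "schwartz = {f. smooth f \<and> (\<forall>\<alpha> js. bounded (range (weighted_deriv \<alpha> js f)))}"

definition schwartz_seminorm ::
    "('d::finite \<Rightarrow> nat) \<Rightarrow> 'd list \<Rightarrow> (real^'d \<Rightarrow> real) \<Rightarrow> real" where
  "schwartz_seminorm \<alpha> js f = (SUP x. \<bar>weighted_deriv \<alpha> js f x\<bar>)"

definition schwartz_topology :: "(real^'d::finite \<Rightarrow> real) topology" where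
  "schwartz_topology = topology_generated_by
     {{g \<in> schwartz. schwartz_seminorm \<alpha> js (\<lambda>x. g x - f x) < e} | f \<alpha> js e.
        f \<in> schwartz \<and> 0 < e}"

text \<open>Functionals on the Schwartz space are HOL functions that are \<open>undefined\<close> outside it, so that
  equal functionals are equal as elements of the dual.\<close>

definition tempered_distributions :: "((real^'d::finite \<Rightarrow> real) \<Rightarrow> real) set" where
  "tempered_distributions = {\<phi> \<in> extensional schwartz.
     (\<forall>f\<in>schwartz. \<forall>g\<in>schwartz. \<forall>a b.
        \<phi> (\<lambda>x. a * f x + b * g x) = a * \<phi> f + b * \<phi> g) \<and>
     continuous_map schwartz_topology euclideanreal \<phi>}"

definition cylinder_algebra :: "((real^'d::finite \<Rightarrow> real) \<Rightarrow> real) measure" where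
  "cylinder_algebra = sigma tempered_distributions
     {{\<phi> \<in> tempered_distributions. \<phi> f \<in> B} | f B. f \<in> schwartz \<and> B \<in> sets borel}"

definition fourier :: "(real^'d::finite \<Rightarrow> complex) \<Rightarrow> real^'d \<Rightarrow> complex" where
  "fourier g p = (LINT x|lborel. iexp (- (p \<bullet> x)) * g x)"

definition inverse_fourier :: "(real^'d::finite \<Rightarrow> complex) \<Rightarrow> real^'d \<Rightarrow> complex" where
  "inverse_fourier h x =
     complex_of_real (1 / (2 * pi) ^ CARD('d)) * (LINT p|lborel. iexp (p \<bullet> x) * h p)"

text \<open>The operator \<open>(m\<^sup>2 - \<Delta>) powr (-1/2)\<close>. With the angular frequency convention above, the
  symbol of the Laplacian is \<open>- (norm p)\<^sup>2\<close>.\<close>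

definition inv_sqrt_op :: "real \<Rightarrow> (real^'d::finite \<Rightarrow> complex) \<Rightarrow> real^'d \<Rightarrow> complex" where
  "inv_sqrt_op m g = inverse_fourier
     (\<lambda>p. complex_of_real ((m\<^sup>2 + (norm p)\<^sup>2) powr (- 1 / 2)) * fourier g p)"

text \<open>For real Schwartz functions the value is real, since the multiplier is real and even.\<close>

definition covariance ::
    "real \<Rightarrow> (real^'d::finite \<Rightarrow> real) \<Rightarrow> (real^'d \<Rightarrow> real) \<Rightarrow> complex" where
  "covariance m f g =
     1 / 2 * (LINT x|lborel. complex_of_real (f x) * inv_sqrt_op m (\<lambda>y. complex_of_real (g y)) x)"

definition gaussian_measure ::
    "real \<Rightarrow> ((real^'d::finite \<Rightarrow> real) \<Rightarrow> real) measure \<Rightarrow> bool" where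
  "gaussian_measure m \<mu> \<longleftrightarrow> prob_space \<mu> \<and> sets \<mu> = sets cylinder_algebra \<and>
     (\<forall>f\<in>schwartz. (LINT \<phi>|\<mu>. iexp (\<phi> f)) = exp (- 1 / 2 * covariance m f f))"

definition supported_in :: "(real^'d::finite \<Rightarrow> real) \<Rightarrow> (real^'d) set \<Rightarrow> bool" where
  "supported_in f U \<longleftrightarrow> closure {x. f x \<noteq> 0} \<subseteq> U"

definition signed_measure_on ::
    "(real^'d::finite) set \<Rightarrow> ((real^'d \<Rightarrow> real) \<Rightarrow> real) \<Rightarrow> bool" where
  "signed_measure_on U \<phi> \<longleftrightarrow> (\<exists>\<nu> F. sets \<nu> = sets (restrict_space borel U) \<and> integrable \<nu> F \<and>
     (\<forall>f\<in>schwartz. supported_in f U \<longrightarrow> \<phi> f = (LINT x|\<nu>. f x * F x)))"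

end

theory Submission
  imports Defs "HOL-Computational_Algebra.Polynomial"
begin

text \<open>Cut a small cube into \<open>n\<^sup>d\<close> congruent cells and let \<open>f j\<close> be a smooth bump with values in
  \<open>[0, 1]\<close> supported in the \<open>j\<close>-th cell. As \<open>\<Sum>j. f j \<le> 1\<close>, a distribution that is a signed measure
  near the cube satisfies \<open>(\<Sum>j. \<bar>\<phi> (f j)\<bar>) \<le> C\<close> with \<open>C\<close> independent of \<open>n\<close>. On the other hand
  \<open>\<phi> (f j)\<close> is a centred Gaussian whose variance is at least a constant times
  \<open>n powr (- 2 d) * ln n\<close>, because \<open>(m\<^sup>2 + |p|\<^sup>2) powr (-1/2)\<close> is not integrable at infinity. Hence a
  typical \<open>\<bar>\<phi> (f j)\<bar>\<close> is much larger than \<open>C / n\<^sup>d\<close>, and the probability of the bound tends to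
  \<open>0\<close>. Countably many cubes suffice.\<close>

subsection \<open>Compactly supported smooth bumps\<close>

text \<open>The numerator \<open>P\<close> and the exponent \<open>k\<close> make the family closed
  under differentiation. So every derivative of exp (-1/q), cut off to 0 where q <= 0, is again a
  \<open>bump\<close> with the same \<open>q\<close>.\<close>

definition bump :: "real poly \<Rightarrow> real poly \<Rightarrow> nat \<Rightarrow> real \<Rightarrow> real" where
  "bump q P k t = (if poly q t > 0 then poly P t / poly q t ^ k * exp (- 1 / poly q t) else 0)"

text \<open>One term of the exponential series is at most the whole series.\<close>

lemma power_le_fact_exp:
  fixes x :: real
  assumes "0 \<le> x"
  shows "x ^ n \<le> fact n * exp x"
proof -
  have "sum (\<lambda>k. x ^ k /\<^sub>R fact k) {n} \<le> (\<Sum>k. x ^ k /\<^sub>R fact k)"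
    using assms by (intro sum_le_suminf summable_exp_generic) auto
  then have "x ^ n / fact n \<le> exp x"
    by (simp add: exp_def divide_inverse mult.commute)
  then show ?thesis
    by (simp add: field_simps)
qed

text \<open>With x = 1/q in the bound on x ^ (k + j), the factor exp (-1/q) absorbs the pole of
  order k and still leaves j powers of q. The choice j = 2 gives differentiability at the zeros of
  q.\<close>

lemma bump_bound:
  "\<bar>bump q P k t\<bar> \<le> fact (k + j) * \<bar>poly P t\<bar> * \<bar>poly q t\<bar> ^ j"
proof (cases "poly q t > 0")
  case True
  define s where "s = poly q t"
  have s: "s > 0" using True by (simp add: s_def)
  have "(1 / s) ^ (k + j) \<le> fact (k + j) * exp (1 / s)"
    using s by (intro power_le_fact_exp) auto
  then have "exp (- 1 / s) / s ^ k \<le> fact (k + j) * s ^ j"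
    using s by (simp add: exp_minus power_add field_simps)
  then have "\<bar>poly P t\<bar> * (exp (- 1 / s) / s ^ k) \<le> \<bar>poly P t\<bar> * (fact (k + j) * s ^ j)"
    by (rule mult_left_mono) simp
  moreover have "\<bar>bump q P k t\<bar> = \<bar>poly P t\<bar> * (exp (- 1 / s) / s ^ k)"
    using s True by (simp add: bump_def s_def abs_mult)
  ultimately show ?thesis
    using s by (simp add: s_def mult_ac)
qed (simp add: bump_def)

text \<open>The numerator when P'/q^k - k P q'/q^(k+1) + P q'/q^(k+2) is put over q^(k+2).\<close>

definition bump_deriv_poly :: "real poly \<Rightarrow> real poly \<Rightarrow> nat \<Rightarrow> real poly" where
  "bump_deriv_poly q P k =
     pderiv P * q ^ 2 - of_nat k * P * pderiv q * q + P * pderiv q"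

text \<open>Where q > 0 the formula is differentiated; where q < 0 the function is locally 0. At a
  zero of q the difference quotient is squeezed.\<close>

lemma bump_has_derivative:
  "(bump q P k has_real_derivative bump q (bump_deriv_poly q P k) (k + 2) t) (at t)"
proof (cases "poly q t > 0")
  case True
  have cont: "continuous (at t) (poly q)" by simp
  have ev: "\<forall>\<^sub>F x in nhds t. poly q x > 0"
    using cont True by (metis continuous_at order_tendsto_iff tendsto_at_iff_tendsto_nhds)
  have "((\<lambda>x. poly P x / poly q x ^ k * exp (- 1 / poly q x)) has_real_derivative
      bump q (bump_deriv_poly q P k) (k + 2) t) (at t)"
    using True
    apply (auto intro!: derivative_eq_intros simp: bump_def bump_deriv_poly_def)
    apply (cases k)
    apply (auto simp: field_simps power2_eq_square)
    done
  then show ?thesis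
    by (rule DERIV_cong_ev[OF refl _ refl, THEN iffD1, rotated])
       (use ev in \<open>eventually_elim, auto simp: bump_def\<close>)
next
  case False
  show ?thesis
  proof (cases "poly q t = 0")
    case True
    \<comment> \<open>\<open>G\<close> dominates the bump by \<open>bump_bound\<close> with j = 2.
      Its factor q^2 vanishes to second order at t, so both its value and its derivative are 0
      there.\<close>
    define G where "G x = fact (k + 2) * poly P x * poly q x ^ 2" for x
    have "(G has_real_derivative 0) (at t)"
      unfolding G_def using True by (auto intro!: derivative_eq_intros)
    then have "((\<lambda>y. (G y - G t) / (y - t)) \<longlongrightarrow> 0) (at t)"
      by (simp add: has_field_derivative_iff)
    then have "((\<lambda>y. \<bar>(G y - G t) / (y - t)\<bar>) \<longlongrightarrow> 0) (at t)"
      by (rule tendsto_rabs_zero)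
    then have "((\<lambda>y. (bump q P k y - bump q P k t) / (y - t)) \<longlongrightarrow> 0) (at t)"
      apply (rule Lim_null_comparison[rotated])
      using True bump_bound[of q P k _ 2]
      by (auto simp: G_def bump_def[of q P k t] abs_mult intro!: divide_right_mono always_eventually)
    then show ?thesis
      using True by (simp add: has_field_derivative_iff bump_def[of _ _ _ t])
  next
    case nz: False
    have "continuous (at t) (poly q)" by simp
    then have ev: "\<forall>\<^sub>F x in nhds t. poly q x < 0"
      using False nz by (metis continuous_at order_tendsto_iff tendsto_at_iff_tendsto_nhds linorder_less_linear)
    have "((\<lambda>x. 0::real) has_real_derivative bump q (bump_deriv_poly q P k) (k + 2) t) (at t)"
      using False by (simp add: bump_def)
    then show ?thesis
      by (rule DERIV_cong_ev[OF refl _ refl, THEN iffD1, rotated])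
         (use ev in \<open>eventually_elim, auto simp: bump_def\<close>)
  qed
qed

lemma continuous_on_bump [continuous_intros]: "continuous_on S (bump q P k)"
  using DERIV_isCont[OF bump_has_derivative] continuous_at_imp_continuous_on by blast

lemma borel_measurable_bump [measurable]: "bump q P k \<in> borel_measurable borel"
  using borel_measurable_continuous_onI continuous_on_bump by blast

subsection \<open>Fourier transforms of bumps on the line\<close>

text \<open>In the coordinate s = (t - a)/h this is s (1 - s). Dividing by h^2 makes the cell bumps
  of all widths rescalings of one profile, with height independent of h.\<close>

definition ivl_poly :: "real \<Rightarrow> real \<Rightarrow> real poly" where
  "ivl_poly a h = smult (1 / h\<^sup>2) ([:- a, 1:] * [:a + h, - 1:])"

lemma poly_ivl_poly: "poly (ivl_poly a h) t = (t - a) * (a + h - t) / h\<^sup>2"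
proof -
  have "poly [:- a, 1:] t * poly [:a + h, - 1:] t = (t - a) * (a + h - t)"
    by simp
  then show ?thesis
    by (simp add: ivl_poly_def del: mult_pCons_left mult_pCons_right poly_pCons)
qed

lemma bump_ivl_eq_0:
  assumes "0 < h" "t \<notin> {a<..<a + h}"
  shows "bump (ivl_poly a h) P k t = 0"
proof -
  have "(t - a) * (a + h - t) \<le> 0"
    using assms by (auto simp: mult_le_0_iff)
  then have "poly (ivl_poly a h) t \<le> 0"
    unfolding poly_ivl_poly by (rule divide_nonpos_nonneg) simp
  then show ?thesis
    by (simp add: bump_def)
qed

lemma integrable_zero_outside_Icc:
  fixes f :: "real \<Rightarrow> 'b::{banach, second_countable_topology}"
  assumes "continuous_on {a..b} f" "\<And>t. t \<notin> {a..b} \<Longrightarrow> f t = 0"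
  shows "integrable lborel f"
proof -
  have "(\<lambda>t. indicator {a..b} t *\<^sub>R f t) = f"
    using assms(2) by (auto simp: indicator_def fun_eq_iff)
  then show ?thesis
    using borel_integrable_compact[OF compact_Icc assms(1)] by simp
qed

lemma integrable_bump:
  assumes "0 < h"
  shows "integrable lborel (bump (ivl_poly a h) P k)"
  by (rule integrable_zero_outside_Icc[of a "a + h"])
     (auto intro!: continuous_intros bump_ivl_eq_0[OF assms])

definition fourier1 :: "(real \<Rightarrow> real) \<Rightarrow> real \<Rightarrow> complex" where
  "fourier1 g p = (LINT t|lborel. iexp (- (p * t)) * complex_of_real (g t))"

lemma integrable_iexp_mult:
  fixes g :: "'a::euclidean_space \<Rightarrow> complex" and l :: "'a \<Rightarrow> real"
  assumes "integrable lborel g" "l \<in> borel_measurable borel"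
  shows "integrable lborel (\<lambda>t. iexp (l t) * g t)"
  by (rule Bochner_Integration.integrable_bound[OF assms(1)])
     (use assms in \<open>auto simp: norm_mult\<close>)

lemma borel_measurable_fourier1 [measurable]:
  assumes [measurable]: "g \<in> borel_measurable borel"
  shows "fourier1 g \<in> borel_measurable borel"
  unfolding fourier1_def by measurable

lemma norm_fourier1_le:
  assumes "integrable lborel g"
  shows "norm (fourier1 g p) \<le> (LINT t|lborel. \<bar>g t\<bar>)"
proof -
  have "norm (fourier1 g p) \<le> (LINT t|lborel. norm (iexp (- (p * t)) * complex_of_real (g t)))"
    unfolding fourier1_def by (rule integral_norm_bound)
  then show ?thesis by (simp add: norm_mult)
qed

text \<open>The function \<open>t \<mapsto> (g' t + i p g t) exp (- i p t)\<close> vanishes at both ends of the support, and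
  its derivative is \<open>(g'' t + p\<^sup>2 g t) exp (- i p t)\<close>: this replaces two integrations by parts.\<close>

lemma fourier1_second_derivative:
  fixes g g' g'' :: "real \<Rightarrow> real"
  assumes "a \<le> b"
    and g': "\<And>t. (g has_real_derivative g' t) (at t)"
    and g'': "\<And>t. (g' has_real_derivative g'' t) (at t)"
    and cont: "continuous_on UNIV g''"
    and zero: "\<And>t. t \<notin> {a<..<b} \<Longrightarrow> g t = 0 \<and> g' t = 0 \<and> g'' t = 0"
  shows "fourier1 g'' p + of_real (p\<^sup>2) * fourier1 g p = 0"
proof -
  have cg: "continuous_on S g" and cg'': "continuous_on S g''" for S
    using DERIV_isCont[OF g'] continuous_at_imp_continuous_on cont continuous_on_subset by blast+
  define F where "F t = (complex_of_real (g' t) + \<i> * of_real p * of_real (g t)) * iexp (- (p * t))" for t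
  define f where "f t = complex_of_real (g'' t + p\<^sup>2 * g t) * iexp (- (p * t))" for t
  \<comment> \<open>Chain rule for the complex exponential composed with the embedding of the
    reals.\<close>
  have iexp': "((\<lambda>t. iexp (- (p * t))) has_vector_derivative - (\<i> * of_real p) * iexp (- (p * t)))
      (at t within S)" for t S
  proof -
    have "((\<lambda>z. exp (- (\<i> * of_real p) * z)) has_field_derivative
        - (\<i> * of_real p) * exp (- (\<i> * of_real p) * of_real t)) (at (of_real t) within of_real ` S)"
      by (auto intro!: derivative_eq_intros)
    moreover have "(complex_of_real has_vector_derivative 1) (at t within S)"
      using has_vector_derivative_of_real[of "\<lambda>x. x" 1] by (auto intro!: derivative_eq_intros)
    ultimately have "((\<lambda>z. exp (- (\<i> * of_real p) * z)) \<circ> complex_of_real has_vector_derivative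
        1 * (- (\<i> * of_real p) * exp (- (\<i> * of_real p) * of_real t))) (at t within S)"
      by (intro field_vector_diff_chain_within)
    then show ?thesis
      by (simp add: o_def mult_ac)
  qed
  have "(F has_vector_derivative f t) (at t within S)" for t S
  proof -
    have 1: "((\<lambda>t. complex_of_real (g' t)) has_vector_derivative of_real (g'' t)) (at t within S)"
      and 2: "((\<lambda>t. complex_of_real (g t)) has_vector_derivative of_real (g' t)) (at t within S)"
      using g' g'' by (blast intro: has_vector_derivative_of_real has_field_derivative_at_within)+
    have "((\<lambda>t. complex_of_real (g' t) + \<i> * of_real p * of_real (g t)) has_vector_derivative
        complex_of_real (g'' t) + \<i> * of_real p * of_real (g' t)) (at t within S)"
      by (intro has_vector_derivative_add has_vector_derivative_mult_right 1 2)
    from has_vector_derivative_mult[OF this iexp'] show ?thesis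
      unfolding F_def
      by (rule has_vector_derivative_eq_rhs) (simp add: f_def algebra_simps power2_eq_square)
  qed
  moreover have "continuous_on {a..b} f"
    unfolding f_def by (intro continuous_intros cg cg'')
  ultimately have "(LINT t|lborel. indicator {a..b} t *\<^sub>R f t) = F b - F a"
    using \<open>a \<le> b\<close> by (intro integral_FTC_Icc) auto
  also have "F b - F a = 0"
    using zero[of a] zero[of b] by (simp add: F_def)
  also have "(\<lambda>t. indicator {a..b} t *\<^sub>R f t) = f"
  proof
    fix t
    have "t \<notin> {a..b} \<Longrightarrow> f t = 0"
      using zero[of t] by (auto simp: f_def)
    then show "indicator {a..b} t *\<^sub>R f t = f t"
      by (auto simp: indicator_def)
  qed
  finally have f0: "(LINT t|lborel. f t) = 0" .
  have int: "integrable lborel (\<lambda>t. iexp (- (p * t)) * complex_of_real (u t))"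
    if "continuous_on {a..b} u" "\<And>t. t \<notin> {a<..<b} \<Longrightarrow> u t = 0" for u
    using that by (intro integrable_iexp_mult integrable_of_real integrable_zero_outside_Icc[of a b]) auto
  have "fourier1 g'' p + of_real (p\<^sup>2) * fourier1 g p =
      (LINT t|lborel. iexp (- (p * t)) * complex_of_real (g'' t) +
         of_real (p\<^sup>2) * (iexp (- (p * t)) * complex_of_real (g t)))"
    unfolding fourier1_def using int[of g] int[of g''] zero cg cg''
    by (subst Bochner_Integration.integral_add) auto
  also have "\<dots> = (LINT t|lborel. f t)"
    by (simp add: f_def algebra_simps)
  finally show ?thesis using f0 by simp
qed

text \<open>The second derivative is again a bump, hence integrable, so both the transform and its
  multiple by p^2 are bounded. This gives decay like 1/(1 + p^2).\<close>

lemma integrable_fourier1_bump: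
  assumes "0 < h"
  shows "integrable lborel (fourier1 (bump (ivl_poly a h) P k))"
proof -
  define q where "q = ivl_poly a h"
  define g where "g = bump q P k"
  define P' where "P' = bump_deriv_poly q P k"
  define g'' where "g'' = bump q (bump_deriv_poly q P' (k + 2)) (k + 2 + 2)"
  have int: "integrable lborel g" "integrable lborel g''"
    unfolding g_def g''_def q_def by (intro integrable_bump assms)+
  have eq: "fourier1 g'' p + of_real (p\<^sup>2) * fourier1 g p = 0" for p
  proof (rule fourier1_second_derivative[of a "a + h"])
    show "(g has_real_derivative bump q P' (k + 2) t) (at t)" for t
      unfolding g_def P'_def by (rule bump_has_derivative)
    show "(bump q P' (k + 2) has_real_derivative g'' t) (at t)" for t
      unfolding g''_def by (rule bump_has_derivative)
  qed (use assms in \<open>auto simp: g_def g''_def q_def bump_ivl_eq_0 intro!: continuous_intros\<close>)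
  define C where "C = (LINT t|lborel. \<bar>g t\<bar>) + (LINT t|lborel. \<bar>g'' t\<bar>)"
  have bd: "norm (fourier1 g p) \<le> C * inverse (1 + p\<^sup>2)" for p
  proof -
    have "of_real (p\<^sup>2) * fourier1 g p = - fourier1 g'' p"
      using eq[of p] by (simp add: eq_neg_iff_add_eq_0 add.commute)
    then have "p\<^sup>2 * norm (fourier1 g p) = norm (fourier1 g'' p)"
      by (metis norm_minus_cancel norm_mult norm_of_real abs_of_nonneg zero_le_power2)
    then have "(1 + p\<^sup>2) * norm (fourier1 g p) \<le> C"
      using norm_fourier1_le[OF int(1), of p] norm_fourier1_le[OF int(2), of p]
      by (simp add: C_def distrib_right)
    moreover have "1 + p\<^sup>2 > 0"
      by (simp add: add_pos_nonneg)
    ultimately show ?thesis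
      by (simp add: field_simps)
  qed
  have "integrable lborel (\<lambda>p::real. C * inverse (1 + p\<^sup>2))"
    using integrable_inverse_1_plus_square by (simp add: set_integrable_def)
  then have "integrable lborel (fourier1 g)"
    by (rule Bochner_Integration.integrable_bound)
       (use bd in \<open>auto simp: g_def intro!: always_eventually order_trans[OF _ abs_ge_self]\<close>)
  then show ?thesis
    by (simp add: g_def q_def)
qed

section \<open>Lower bounds for a cell bump and its transform at low frequency\<close>

abbreviation cell_bump :: "real \<Rightarrow> real \<Rightarrow> real \<Rightarrow> real" where
  "cell_bump a h \<equiv> bump (ivl_poly a h) 1 0"

lemma cell_bump_nonneg: "0 \<le> cell_bump a h t"
  by (simp add: bump_def)

lemma cell_bump_le_1: "cell_bump a h t \<le> 1"
  by (simp add: bump_def)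

text \<open>On the middle half of the interval s (1 - s) >= 3/16 >= 1/8, so the bump is at least exp
  (-8) on a set of length h/2.\<close>

lemma integral_cell_bump_ge:
  assumes h: "0 < h"
  shows "(LINT t|lborel. cell_bump a h t) \<ge> exp (- 8) / 2 * h"
proof -
  have "exp (- 8) * indicator {a + h / 4..a + 3 * h / 4} t \<le> cell_bump a h t" for t
  proof (cases "t \<in> {a + h / 4..a + 3 * h / 4}")
    case True
    define s where "s = (t - a) / h"
    have s: "1 / 4 \<le> s" "s \<le> 3 / 4"
      using True h by (auto simp: s_def field_simps)
    have eq: "poly (ivl_poly a h) t = s * (1 - s)"
      using h by (simp add: poly_ivl_poly s_def field_simps power2_eq_square)
    have "s * (1 - s) - 3 / 16 = (s - 1 / 4) * (3 / 4 - s)"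
      by (simp add: field_simps)
    moreover have "(s - 1 / 4) * (3 / 4 - s) \<ge> 0"
      using s by simp
    ultimately have "s * (1 - s) \<ge> 1 / 8"
      by linarith
    then show ?thesis
      using True by (simp add: bump_def eq field_simps)
  qed (simp add: cell_bump_nonneg)
  then have "(LINT t|lborel. exp (- 8) * indicator {a + h / 4..a + 3 * h / 4} t) \<le>
      (LINT t|lborel. cell_bump a h t)"
    using h by (intro integral_mono integrable_bump integrable_mult_right integrable_real_indicator) auto
  moreover have "(LINT t|lborel. exp (- 8) * indicator {a + h / 4..a + 3 * h / 4} t) = exp (- 8) / 2 * h"
    using h by (simp add: field_simps)
  ultimately show ?thesis by linarith
qed

lemma cos_ge_half: "\<bar>x::real\<bar> \<le> 1 \<Longrightarrow> cos x \<ge> 1 / 2"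
proof -
  assume "\<bar>x\<bar> \<le> 1"
  then have "cos (pi / 3) \<le> cos \<bar>x\<bar>"
    using pi_gt3 by (intro cos_monotone_0_pi_le) auto
  then show ?thesis by (simp add: cos_60)
qed

text \<open>Moving the origin to a only changes the transform by a unimodular factor. Afterwards all
  phases on the support are at most 1 in absolute value, so their cosines are at least 1/2 and at
  least half of the mass survives.\<close>

lemma norm_fourier1_cell_bump_ge:
  assumes h: "0 < h" and p: "\<bar>p\<bar> * h \<le> 1"
  shows "norm (fourier1 (cell_bump a h) p) \<ge> exp (- 8) / 4 * h"
proof -
  let ?g = "cell_bump a h"
  have int: "integrable lborel ?g" by (rule integrable_bump[OF h])
  have inti: "integrable lborel (\<lambda>t. iexp (- (p * (t - a))) * complex_of_real (?g t))"
    using int by (intro integrable_iexp_mult integrable_of_real) auto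
  have "exp (- 8) / 4 * h \<le> (LINT t|lborel. 1 / 2 * ?g t)"
    using integral_cell_bump_ge[OF h, of a] by (simp add: mult.commute)
  also have "\<dots> \<le> (LINT t|lborel. Re (iexp (- (p * (t - a))) * complex_of_real (?g t)))"
  proof (intro integral_mono integrable_mult_right int integrable_Re inti)
    fix t
    show "1 / 2 * ?g t \<le> Re (iexp (- (p * (t - a))) * complex_of_real (?g t))"
    proof (cases "t \<in> {a<..<a + h}")
      case True
      then have "\<bar>p\<bar> * \<bar>t - a\<bar> \<le> \<bar>p\<bar> * h"
        by (intro mult_left_mono) auto
      then have "cos (p * (t - a)) \<ge> 1 / 2"
        using p by (intro cos_ge_half) (auto simp: abs_mult)
      then have "1 / 2 * ?g t \<le> cos (p * (t - a)) * ?g t"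
        by (rule mult_right_mono) (rule cell_bump_nonneg)
      then show ?thesis
        by (simp add: exp_eq_polar Re_exp)
    qed (simp add: bump_ivl_eq_0[OF h])
  qed
  also have "\<dots> = Re (LINT t|lborel. iexp (- (p * (t - a))) * complex_of_real (?g t))"
    by (rule integral_Re[OF inti])
  also have "\<dots> \<le> norm (LINT t|lborel. iexp (- (p * (t - a))) * complex_of_real (?g t))"
    by (rule complex_Re_le_cmod)
  also have "(LINT t|lborel. iexp (- (p * (t - a))) * complex_of_real (?g t)) =
      iexp (p * a) * fourier1 ?g p"
    unfolding fourier1_def
    by (subst integral_mult_right_zero[symmetric])
       (auto intro!: Bochner_Integration.integral_cong simp: exp_add[symmetric] algebra_simps)
  finally show ?thesis
    by (simp add: norm_mult)
qed

subsection \<open>Products of bumps\<close>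

text \<open>Separate \<open>P\<close> and \<open>k\<close> for each coordinate keep all partial
  derivatives inside the family, since each differentiation changes one factor only.\<close>

definition prod_bump ::
    "('d::finite \<Rightarrow> real poly) \<Rightarrow> ('d \<Rightarrow> real poly) \<Rightarrow> ('d \<Rightarrow> nat) \<Rightarrow> real^'d \<Rightarrow> real" where
  "prod_bump q P k x = (\<Prod>i\<in>UNIV. bump (q i) (P i) (k i) (x $ i))"

lemma partial_deriv_prod_bump:
  "partial_deriv i (prod_bump q P k) =
     prod_bump q (P(i := bump_deriv_poly (q i) (P i) (k i))) (k(i := k i + 2))"
proof
  fix x :: "real^'a"
  let ?R = "\<Prod>l\<in>UNIV - {i}. bump (q l) (P l) (k l) (x $ l)"
  have "prod_bump q P k (x + t *\<^sub>R axis i 1) = bump (q i) (P i) (k i) (x $ i + t) * ?R" for t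
    unfolding prod_bump_def by (subst prod.remove[of _ i]) (auto simp: axis_def)
  moreover have "((\<lambda>t. bump (q i) (P i) (k i) (x $ i + t) * ?R) has_real_derivative
      bump (q i) (bump_deriv_poly (q i) (P i) (k i)) (k i + 2) (x $ i) * ?R) (at 0)"
    using bump_has_derivative[of "q i" "P i" "k i" "x $ i"]
      DERIV_shift[of "bump (q i) (P i) (k i)" _ 0 "x $ i"]
    by (intro DERIV_cmult_right) (simp add: add.commute)
  ultimately have "partial_deriv i (prod_bump q P k) x =
      bump (q i) (bump_deriv_poly (q i) (P i) (k i)) (k i + 2) (x $ i) * ?R"
    unfolding partial_deriv_def by (simp add: DERIV_imp_deriv)
  also have "\<dots> = prod_bump q (P(i := bump_deriv_poly (q i) (P i) (k i))) (k(i := k i + 2)) x"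
    unfolding prod_bump_def by (subst (2) prod.remove[of _ i]) auto
  finally show "partial_deriv i (prod_bump q P k) x =
      prod_bump q (P(i := bump_deriv_poly (q i) (P i) (k i))) (k(i := k i + 2)) x" .
qed

lemma partial_derivs_prod_bump: "\<exists>P' k'. partial_derivs js (prod_bump q P k) = prod_bump q P' k'"
proof (induction js)
  case (Cons i js)
  then show ?case
    by (metis partial_derivs.simps(2) partial_deriv_prod_bump)
qed auto

lemma prod_bump_differentiable: "prod_bump q P k differentiable_on UNIV"
proof -
  have D: "((\<lambda>x::real^'a. bump (q i) (P i) (k i) (x $ i)) has_derivative
      (\<lambda>y. bump (q i) (bump_deriv_poly (q i) (P i) (k i)) (k i + 2) (x $ i) * (y $ i)))
      (at x within UNIV)" for x i
    by (rule has_derivative_compose[where f = "\<lambda>x::real^'a. x $ i"])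
       (use bump_has_derivative[of "q i" "P i" "k i" "x $ i"] in
         \<open>auto simp: has_field_derivative_def intro: bounded_linear_imp_has_derivative bounded_linear_vec_nth\<close>)
  show ?thesis
    unfolding differentiable_on_def differentiable_def prod_bump_def
    using has_derivative_prod[where f = "\<lambda>i x. bump (q i) (P i) (k i) (x $ i)" and I = UNIV, OF D]
    by blast
qed

lemma bounded_weighted_bump:
  assumes "0 < h"
  shows "\<exists>B. \<forall>t. \<bar>t ^ n * bump (ivl_poly a h) P k t\<bar> \<le> B"
proof -
  let ?f = "\<lambda>t. t ^ n * bump (ivl_poly a h) P k t"
  have "bounded (?f ` {a..a + h})"
    by (intro compact_imp_bounded compact_continuous_image continuous_intros) auto
  then obtain B where "\<forall>y\<in>?f ` {a..a + h}. norm y \<le> B"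
    unfolding bounded_iff by (rule exE)
  then have B: "\<And>t. t \<in> {a..a + h} \<Longrightarrow> \<bar>?f t\<bar> \<le> B"
    by simp
  have "\<bar>?f t\<bar> \<le> max B 0" for t
    using B[of t] bump_ivl_eq_0[OF assms, of t a P k] by (cases "t \<in> {a..a + h}") auto
  then show ?thesis by blast
qed

text \<open>The monomial splits over the coordinates, so it suffices to bound each factor, a
  continuous function with compact support.\<close>

lemma bounded_weighted_prod_bump:
  assumes "0 < h"
  shows "bounded (range (\<lambda>x::real^'d. (\<Prod>i\<in>UNIV. (x $ i) ^ \<alpha> i) * prod_bump (\<lambda>i. ivl_poly (a i) h) P k x))"
proof -
  have "\<forall>i. \<exists>B. \<forall>t. \<bar>t ^ \<alpha> i * bump (ivl_poly (a i) h) (P i) (k i) t\<bar> \<le> B"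
    using bounded_weighted_bump[OF assms] by blast
  then obtain B where B: "\<And>i t. \<bar>t ^ \<alpha> i * bump (ivl_poly (a i) h) (P i) (k i) t\<bar> \<le> B i"
    by metis
  show ?thesis
    unfolding bounded_iff
  proof (intro exI ballI)
    fix y assume "y \<in> range (\<lambda>x::real^'d. (\<Prod>i\<in>UNIV. (x $ i) ^ \<alpha> i) * prod_bump (\<lambda>i. ivl_poly (a i) h) P k x)"
    then obtain x :: "real^'d" where
      "y = (\<Prod>i\<in>UNIV. (x $ i) ^ \<alpha> i) * prod_bump (\<lambda>i. ivl_poly (a i) h) P k x"
      by blast
    then have "norm y = (\<Prod>i\<in>UNIV. \<bar>(x $ i) ^ \<alpha> i * bump (ivl_poly (a i) h) (P i) (k i) (x $ i)\<bar>)"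
      unfolding prod_bump_def by (simp add: prod.distrib abs_prod abs_mult)
    also have "\<dots> \<le> (\<Prod>i\<in>UNIV. B i)"
      using B by (intro prod_mono) auto
    finally show "norm y \<le> (\<Prod>i\<in>UNIV. B i)" .
  qed
qed

lemma prod_bump_schwartz:
  assumes "0 < h"
  shows "prod_bump (\<lambda>i. ivl_poly (a i) h) P k \<in> schwartz"
proof -
  have "partial_derivs js (prod_bump (\<lambda>i. ivl_poly (a i) h) P k) differentiable_on UNIV" for js
    using partial_derivs_prod_bump[of js "\<lambda>i. ivl_poly (a i) h" P k] prod_bump_differentiable by metis
  moreover have "bounded (range (weighted_deriv \<alpha> js (prod_bump (\<lambda>i. ivl_poly (a i) h) P k)))" for \<alpha> js
  proof -
    obtain P' k' where "partial_derivs js (prod_bump (\<lambda>i. ivl_poly (a i) h) P k) =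
        prod_bump (\<lambda>i. ivl_poly (a i) h) P' k'"
      using partial_derivs_prod_bump by blast
    then have "weighted_deriv \<alpha> js (prod_bump (\<lambda>i. ivl_poly (a i) h) P k) =
        (\<lambda>x. (\<Prod>i\<in>UNIV. (x $ i) ^ \<alpha> i) * prod_bump (\<lambda>i. ivl_poly (a i) h) P' k' x)"
      by (simp add: weighted_deriv_def fun_eq_iff)
    then show ?thesis
      using bounded_weighted_prod_bump[OF assms] by simp
  qed
  ultimately show ?thesis
    by (simp add: schwartz_def smooth_def)
qed

text \<open>The scalar is absorbed into the polynomial of one coordinate. Multiples are needed to
  obtain characteristic functions of evaluations.\<close>

lemma scaled_prod_bump_schwartz:
  assumes "0 < h"
  shows "(\<lambda>x. s * prod_bump (\<lambda>i. ivl_poly (a i) h) P k x) \<in> schwartz"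
proof -
  \<comment> \<open>Some coordinate exists because types are non-empty: this is d >= 1.\<close>
  obtain i :: 'a where True by simp
  have "s * prod_bump q P k x = prod_bump q (P(i := smult s (P i))) k x" for q and x :: "real^'a"
    unfolding prod_bump_def by (subst (1 2) prod.remove[of _ i]) (auto simp: bump_def)
  then show ?thesis
    using prod_bump_schwartz[OF assms] by simp
qed

lemma continuous_on_prod_bump: "continuous_on S (prod_bump q P k)"
  using prod_bump_differentiable differentiable_imp_continuous_on continuous_on_subset by blast

lemma borel_measurable_prod_bump [measurable]: "prod_bump q P k \<in> borel_measurable borel"
  using borel_measurable_continuous_onI continuous_on_prod_bump by blast

section \<open>Integrals and Fourier transforms of products over the coordinates\<close>

lemma lborel_product_integral:
  fixes f :: "'a::euclidean_space \<Rightarrow> real \<Rightarrow> 'b::{real_normed_field, banach, second_countable_topology}"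
  assumes int: "\<And>b. b \<in> Basis \<Longrightarrow> integrable lborel (f b)"
  shows "integrable lborel (\<lambda>x. \<Prod>b\<in>Basis. f b (x \<bullet> b))"
    and "(LINT x|lborel. (\<Prod>b\<in>Basis. f b (x \<bullet> b))) = (\<Prod>b\<in>Basis. (LINT t|lborel. f b t))"
proof -
  interpret product_sigma_finite "\<lambda>b::'a. lborel :: real measure" ..
  have meas: "\<And>b. b \<in> Basis \<Longrightarrow> f b \<in> borel_measurable borel"
    using borel_measurable_integrable[OF int] by simp
  have [measurable]: "(\<lambda>x::'a. \<Prod>b\<in>Basis. f b (x \<bullet> b)) \<in> borel_measurable borel"
    by (intro borel_measurable_prod measurable_compose[OF _ meas]) auto
  have eq: "(\<Prod>b\<in>Basis. f b ((\<Sum>c\<in>Basis. y c *\<^sub>R c) \<bullet> b)) = (\<Prod>b\<in>Basis. f b (y b))" for y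
    by (intro prod.cong refl) simp
  show "integrable lborel (\<lambda>x. \<Prod>b\<in>Basis. f b (x \<bullet> b))"
    \<comment> \<open>Lebesgue measure is the image of a product of one-dimensional Lebesgue
      measures, which reduces the claim to Fubini for finite products.\<close>
    unfolding lborel_eq[where 'a='a]
    by (subst integrable_distr_eq) (auto simp: eq intro!: product_integrable_prod int)
  show "(LINT x|lborel. (\<Prod>b\<in>Basis. f b (x \<bullet> b))) = (\<Prod>b\<in>Basis. (LINT t|lborel. f b t))"
    unfolding lborel_eq[where 'a='a]
    by (subst integral_distr) (auto simp: eq intro!: product_integral_prod int)
qed

lemma
  fixes f :: "'d::finite \<Rightarrow> real \<Rightarrow> 'b::{real_normed_field, banach, second_countable_topology}"
  assumes int: "\<And>i. integrable lborel (f i)"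
  shows integrable_vec_prod: "integrable lborel (\<lambda>x::real^'d. \<Prod>i\<in>UNIV. f i (x $ i))"
    and integral_vec_prod:
      "(LINT x|lborel. (\<Prod>i\<in>UNIV. f i ((x::real^'d) $ i))) = (\<Prod>i\<in>UNIV. (LINT t|lborel. f i t))"
proof -
  define ax :: "'d \<Rightarrow> real^'d" where "ax i = axis i 1" for i
  have inj: "inj ax" by (auto simp: inj_def ax_def axis_eq_axis)
  have basis: "Basis = range ax" by (auto simp: Basis_vec_def ax_def)
  have eq: "(\<Prod>b\<in>Basis. G b) = (\<Prod>i\<in>UNIV. G (ax i))" for G :: "real^'d \<Rightarrow> 'b"
    unfolding basis by (simp add: prod.reindex[OF inj])
  have [simp]: "x \<bullet> ax i = x $ i" for x i
    by (simp add: ax_def inner_axis)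
  have *: "integrable lborel (f (inv ax b))" for b
    by (rule int)
  show "integrable lborel (\<lambda>x::real^'d. \<Prod>i\<in>UNIV. f i (x $ i))"
    using lborel_product_integral(1)[of "\<lambda>b. f (inv ax b)", OF *]
    by (simp add: eq inv_f_f[OF inj])
  show "(LINT x|lborel. (\<Prod>i\<in>UNIV. f i ((x::real^'d) $ i))) = (\<Prod>i\<in>UNIV. (LINT t|lborel. f i t))"
    using lborel_product_integral(2)[of "\<lambda>b. f (inv ax b)", OF *]
    by (simp add: eq inv_f_f[OF inj])
qed

lemma fourier_prod:
  fixes g :: "'d::finite \<Rightarrow> real \<Rightarrow> real" and p :: "real^'d"
  assumes "\<And>i. integrable lborel (g i)"
  shows "fourier (\<lambda>x. complex_of_real (\<Prod>i\<in>UNIV. g i (x $ i))) p = (\<Prod>i\<in>UNIV. fourier1 (g i) (p $ i))"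
proof -
  have "iexp (- (p \<bullet> x)) * complex_of_real (\<Prod>i\<in>UNIV. g i (x $ i)) =
      (\<Prod>i\<in>UNIV. iexp (- (p $ i * x $ i)) * complex_of_real (g i (x $ i)))" for x
    by (simp add: inner_vec_def prod.distrib exp_sum[symmetric] sum_distrib_left sum_negf)
  then have "fourier (\<lambda>x. complex_of_real (\<Prod>i\<in>UNIV. g i (x $ i))) p =
      (LINT x|lborel. (\<Prod>i\<in>UNIV. iexp (- (p $ i * x $ i)) * complex_of_real (g i (x $ i))))"
    by (simp add: fourier_def)
  also have "\<dots> = (\<Prod>i\<in>UNIV. fourier1 (g i) (p $ i))"
    unfolding fourier1_def using assms
    by (intro integral_vec_prod integrable_iexp_mult integrable_of_real) auto
  finally show ?thesis .
qed

subsection \<open>The covariance of a product bump\<close>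

text \<open>As m is nonzero, the weight is bounded by its value at p = 0.\<close>

lemma integrable_inv_sqrt_mult:
  fixes G :: "real^'d::finite \<Rightarrow> complex"
  assumes "m \<noteq> 0" and G: "integrable lborel G"
  shows "integrable lborel (\<lambda>p. complex_of_real ((m\<^sup>2 + (norm p)\<^sup>2) powr (- 1 / 2)) * G p)"
proof (rule Bochner_Integration.integrable_bound)
  show "integrable lborel (\<lambda>p. complex_of_real (m\<^sup>2 powr (- 1 / 2)) * G p)"
    using G by simp
  have [measurable]: "G \<in> borel_measurable borel"
    using borel_measurable_integrable[OF G] by simp
  show "(\<lambda>p. complex_of_real ((m\<^sup>2 + (norm p)\<^sup>2) powr (- 1 / 2)) * G p) \<in> borel_measurable lborel"
    by measurable
  show "AE p in lborel. norm (complex_of_real ((m\<^sup>2 + (norm p)\<^sup>2) powr (- 1 / 2)) * G p) \<le>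
      norm (complex_of_real (m\<^sup>2 powr (- 1 / 2)) * G p)"
    using \<open>m \<noteq> 0\<close> by (intro always_eventually allI) (auto simp: norm_mult intro!: mult_right_mono powr_mono2')
qed

lemma cnj_fourier_of_real:
  "cnj (fourier (\<lambda>x. complex_of_real (f x)) p) = (LINT x|lborel. iexp (p \<bullet> x) * complex_of_real (f x))"
proof -
  have "cnj (fourier (\<lambda>x. complex_of_real (f x)) p) =
      (LINT x|lborel. cnj (iexp (- (p \<bullet> x)) * complex_of_real (f x)))"
    unfolding fourier_def by (rule Bochner_Integration.integral_cnj[symmetric])
  then show ?thesis
    by (simp add: exp_cnj)
qed

lemma norm_fourier_le: "norm (fourier g p) \<le> (LINT x|lborel. norm (g x))"
proof -
  have "norm (fourier g p) \<le> (LINT x|lborel. norm (iexp (- (p \<bullet> x)) * g x))"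
    unfolding fourier_def by (rule integral_norm_bound)
  then show ?thesis by (simp add: norm_mult)
qed

text \<open>A Plancherel identity obtained from Fubini alone: integrability of both f and its
  transform makes the double integral absolutely convergent, and integrating over x first produces
  the conjugate of \<open>G\<close>.\<close>

lemma
  fixes f :: "real^'d::finite \<Rightarrow> real"
  defines "G \<equiv> fourier (\<lambda>x. complex_of_real (f x))"
  assumes m: "m \<noteq> 0" and f: "integrable lborel f" and G: "integrable lborel G"
  shows covariance_eq_fourier: "covariance m f f = complex_of_real
      (1 / 2 * (1 / (2 * pi) ^ CARD('d)) *
        (LINT p|lborel. (m\<^sup>2 + (norm p)\<^sup>2) powr (- 1 / 2) * (norm (G p))\<^sup>2))"
    and integrable_weighted_fourier_square:
      "integrable lborel (\<lambda>p. (m\<^sup>2 + (norm p)\<^sup>2) powr (- 1 / 2) * (norm (G p))\<^sup>2)"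
proof -
  define w where "w p = (m\<^sup>2 + (norm p)\<^sup>2) powr (- 1 / 2)" for p :: "real^'d"
  define H where "H p = complex_of_real (w p) * G p" for p
  define c where "c = complex_of_real (1 / (2 * pi) ^ CARD('d))"
  have H: "integrable lborel H"
    unfolding H_def w_def by (rule integrable_inv_sqrt_mult[OF m G])
  have [measurable]: "f \<in> borel_measurable borel" "H \<in> borel_measurable borel" "G \<in> borel_measurable borel"
    using borel_measurable_integrable[OF f] borel_measurable_integrable[OF H]
      borel_measurable_integrable[OF G] by simp_all
  have [measurable]: "w \<in> borel_measurable borel"
    unfolding w_def by measurable
  define \<Phi> where "\<Phi> = (\<lambda>(x, p). complex_of_real (f x) * (iexp (p \<bullet> x) * H p))"
  have norm_\<Phi>: "norm (\<Phi> (x, p)) = \<bar>f x\<bar> * norm (H p)" for x p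
    by (simp add: \<Phi>_def norm_mult)
  have int: "integrable (lborel \<Otimes>\<^sub>M lborel) \<Phi>"
  proof (rule lborel_pair.Fubini_integrable)
    show "\<Phi> \<in> borel_measurable (lborel \<Otimes>\<^sub>M lborel)"
      unfolding \<Phi>_def by measurable
    show "integrable lborel (\<lambda>x. LINT p|lborel. norm (\<Phi> (x, p)))"
      using f by (simp add: norm_\<Phi>)
    show "AE x in lborel. integrable lborel (\<lambda>p. \<Phi> (x, p))"
      unfolding \<Phi>_def prod.case
      by (intro always_eventually allI integrable_mult_right integrable_iexp_mult H) simp
  qed
  have sq: "H p * cnj (G p) = complex_of_real (w p * (norm (G p))\<^sup>2)" for p
    unfolding H_def by (simp add: complex_norm_square[symmetric] mult.assoc)
  have "(LINT x|lborel. complex_of_real (f x) * inv_sqrt_op m (\<lambda>y. complex_of_real (f y)) x) =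
      (LINT x|lborel. c * (LINT p|lborel. \<Phi> (x, p)))"
    unfolding inv_sqrt_op_def inverse_fourier_def \<Phi>_def H_def w_def G_def c_def
    by (simp add: mult_ac)
  also have "\<dots> = c * (LINT x|lborel. LINT p|lborel. \<Phi> (x, p))"
    by simp
  also have "(LINT x|lborel. LINT p|lborel. \<Phi> (x, p)) = (LINT p|lborel. LINT x|lborel. \<Phi> (x, p))"
    using lborel_pair.Fubini_integral[of "\<lambda>x p. \<Phi> (x, p)"] int by (simp add: case_prod_beta')
  also have "(\<lambda>p. LINT x|lborel. \<Phi> (x, p)) = (\<lambda>p. H p * cnj (G p))"
  proof
    fix p
    have "(LINT x|lborel. \<Phi> (x, p)) = (LINT x|lborel. H p * (iexp (p \<bullet> x) * complex_of_real (f x)))"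
      unfolding \<Phi>_def by (simp add: mult_ac)
    then show "(LINT x|lborel. \<Phi> (x, p)) = H p * cnj (G p)"
      unfolding G_def cnj_fourier_of_real by simp
  qed
  also have "(LINT p|lborel. H p * cnj (G p)) = complex_of_real (LINT p|lborel. w p * (norm (G p))\<^sup>2)"
    unfolding sq by (rule integral_complex_of_real)
  finally show "covariance m f f = complex_of_real
      (1 / 2 * (1 / (2 * pi) ^ CARD('d)) *
        (LINT p|lborel. (m\<^sup>2 + (norm p)\<^sup>2) powr (- 1 / 2) * (norm (G p))\<^sup>2))"
    unfolding covariance_def c_def w_def by simp
  \<comment> \<open>The transform is bounded by the L1 norm of f, so one factor of |G|^2 is replaced
    by \<open>K\<close> and the rest is the integrable |H|.\<close>
  define K where "K = (LINT x|lborel. \<bar>f x\<bar>)"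
  have "integrable lborel (\<lambda>p. w p * (norm (G p))\<^sup>2)"
  proof (rule Bochner_Integration.integrable_bound)
    show "integrable lborel (\<lambda>p. K * norm (H p))"
      using H by simp
    show "AE p in lborel. norm (w p * (norm (G p))\<^sup>2) \<le> norm (K * norm (H p))"
    proof (intro always_eventually allI)
      fix p
      have "norm (G p) \<le> K"
        unfolding G_def K_def using norm_fourier_le[of "\<lambda>x. complex_of_real (f x)" p] by simp
      then have "norm (G p) * (w p * norm (G p)) \<le> K * (w p * norm (G p))"
        by (intro mult_right_mono) (auto simp: w_def)
      moreover have "K \<ge> 0" by (simp add: K_def)
      ultimately show "norm (w p * (norm (G p))\<^sup>2) \<le> norm (K * norm (H p))"
        by (simp add: H_def norm_mult power2_eq_square mult_ac w_def)
    qed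
    show "(\<lambda>p. w p * (norm (G p))\<^sup>2) \<in> borel_measurable lborel"
      by measurable
  qed
  then show "integrable lborel (\<lambda>p. (m\<^sup>2 + (norm p)\<^sup>2) powr (- 1 / 2) * (norm (G p))\<^sup>2)"
    by (simp add: w_def)
qed

lemma covariance_scale: "covariance m (\<lambda>x. s * f x) (\<lambda>x. s * f x) = complex_of_real (s\<^sup>2) * covariance m f f"
proof -
  have 1: "fourier (\<lambda>x. complex_of_real (s * f x)) p = complex_of_real s * fourier (\<lambda>x. complex_of_real (f x)) p" for p
    unfolding fourier_def
    by (subst integral_mult_right_zero[symmetric]) (simp add: mult_ac)
  have 2: "inv_sqrt_op m (\<lambda>x. complex_of_real (s * f x)) x =
      complex_of_real s * inv_sqrt_op m (\<lambda>x. complex_of_real (f x)) x" for x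
  proof -
    have "(LINT p|lborel. iexp (p \<bullet> x) * (complex_of_real ((m\<^sup>2 + (norm p)\<^sup>2) powr (- 1 / 2)) *
          (complex_of_real s * fourier (\<lambda>x. complex_of_real (f x)) p))) =
        complex_of_real s * (LINT p|lborel. iexp (p \<bullet> x) *
          (complex_of_real ((m\<^sup>2 + (norm p)\<^sup>2) powr (- 1 / 2)) * fourier (\<lambda>x. complex_of_real (f x)) p))"
      by (subst integral_mult_right_zero[symmetric]) (simp add: mult_ac)
    then show ?thesis
      unfolding inv_sqrt_op_def inverse_fourier_def 1 by (simp only: mult_ac)
  qed
  have "(LINT x|lborel. complex_of_real (s * f x) * (complex_of_real s * inv_sqrt_op m (\<lambda>y. complex_of_real (f y)) x)) =
      complex_of_real (s\<^sup>2) * (LINT x|lborel. complex_of_real (f x) * inv_sqrt_op m (\<lambda>y. complex_of_real (f y)) x)"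
    by (subst integral_mult_right_zero[symmetric]) (simp add: mult_ac power2_eq_square)
  then show ?thesis
    unfolding covariance_def 2 by simp
qed

section \<open>Logarithmic lower bound for the variance on a cell\<close>

abbreviation cell_function :: "('d::finite \<Rightarrow> real) \<Rightarrow> real \<Rightarrow> real^'d \<Rightarrow> real" where
  "cell_function a h \<equiv> prod_bump (\<lambda>i. ivl_poly (a i) h) (\<lambda>_. 1) (\<lambda>_. 0)"

lemma integrable_cell_function: "0 < h \<Longrightarrow> integrable lborel (cell_function a h)"
  unfolding prod_bump_def by (intro integrable_vec_prod integrable_bump)

lemma fourier_cell_function:
  "0 < h \<Longrightarrow> fourier (\<lambda>x. complex_of_real (cell_function a h x)) =
     (\<lambda>p. \<Prod>i\<in>UNIV. fourier1 (cell_bump (a i) h) (p $ i))"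
  unfolding prod_bump_def by (intro ext fourier_prod integrable_bump)

lemma integrable_fourier_cell_function:
  "0 < h \<Longrightarrow> integrable lborel (fourier (\<lambda>x. complex_of_real (cell_function a h x)))"
  unfolding fourier_cell_function by (intro integrable_vec_prod integrable_fourier1_bump)

lemma inv_sqrt_weight_ge:
  fixes m r s :: real
  assumes "m \<noteq> 0" "0 \<le> r" "r \<le> s"
  shows "1 / (\<bar>m\<bar> + s) \<le> (m\<^sup>2 + r\<^sup>2) powr (- 1 / 2)"
proof -
  have pos: "m\<^sup>2 + r\<^sup>2 > 0"
    using assms by (simp add: add_pos_nonneg)
  have "sqrt (m\<^sup>2 + r\<^sup>2) \<le> \<bar>m\<bar> + s"
    using sqrt_sum_squares_le_sum_abs[of m r] assms by simp
  moreover have "(m\<^sup>2 + r\<^sup>2) powr (- 1 / 2) = 1 / sqrt (m\<^sup>2 + r\<^sup>2)"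
    using pos by (simp add: powr_minus_divide powr_half_sqrt)
  ultimately show ?thesis
    using pos by (simp add: frac_le)
qed

text \<open>The weight \<open>(m\<^sup>2 + |p|\<^sup>2) powr (-1/2)\<close> is at least \<open>1 / (\<bar>m\<bar> + d + k)\<close> on the \<open>k\<close>-th box of a row of
  unit boxes along one axis; in every dimension these values form a divergent harmonic sum.\<close>

lemma covariance_cell_function:
  fixes a :: "'d::finite \<Rightarrow> real"
  assumes m: "m \<noteq> 0" and h: "0 < h" "real n * h \<le> 1"
  shows "\<exists>v. covariance m (cell_function a h) (cell_function a h) = complex_of_real v \<and>
    v \<ge> 1 / 2 * (1 / (2 * pi) ^ CARD('d)) * (exp (- 8) / 4 * h) ^ (2 * CARD('d)) *
      (\<Sum>k<n. 1 / (\<bar>m\<bar> + real (CARD('d) + k)))"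
proof -
  define G where "G = fourier (\<lambda>x. complex_of_real (cell_function a h x))"
  define W where "W p = (m\<^sup>2 + (norm p)\<^sup>2) powr (- 1 / 2) * (norm (G p))\<^sup>2" for p
  define K where "K = (exp (- 8) / 4 * h) ^ (2 * CARD('d))"
  obtain i0 :: 'd where True by simp
  \<comment> \<open>The k-th box has side [k, k+1) along the axis \<open>i0\<close> and [0, 1) along
    the others, so the boxes are disjoint and have volume 1.\<close>
  define I where "I k i = (if i = i0 then {real k..<real k + 1} else {0..<1})" for k and i :: 'd
  define B where "B k p = (\<Prod>i\<in>UNIV. indicator (I k i) (p $ i) :: real)" for k and p :: "real^'d"
  have K: "K \<ge> 0" using h by (simp add: K_def)
  \<comment> \<open>Coordinates up to n satisfy |p_i| h <= 1, the low-frequency range. Multiplying d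
    one-dimensional bounds and squaring gives the exponent 2 d.\<close>
  have G_ge: "(norm (G p))\<^sup>2 \<ge> K" if "\<And>i. \<bar>p $ i\<bar> \<le> real n" for p
  proof -
    have "(exp (- 8) / 4 * h) ^ CARD('d) = (\<Prod>i\<in>(UNIV::'d set). exp (- 8) / 4 * h)"
      by simp
    also have "\<dots> \<le> (\<Prod>i\<in>UNIV. norm (fourier1 (cell_bump (a i) h) (p $ i)))"
    proof (intro prod_mono conjI norm_fourier1_cell_bump_ge h)
      show "\<bar>p $ i\<bar> * h \<le> 1" for i
        using mult_right_mono[OF that[of i], of h] h by linarith
    qed (use h in auto)
    also have "\<dots> = norm (G p)"
      unfolding G_def fourier_cell_function[OF h(1)] by (simp add: prod_norm)
    finally have "((exp (- 8) / 4 * h) ^ CARD('d))\<^sup>2 \<le> (norm (G p))\<^sup>2"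
      using h by (intro power_mono) auto
    then show ?thesis
      by (simp add: K_def power_mult[symmetric] mult.commute)
  qed
  have W_nonneg: "W p \<ge> 0" for p
    by (simp add: W_def)
  have B_eq: "B k p = (if \<forall>i. p $ i \<in> I k i then 1 else 0)" for k p
    unfolding B_def by (auto simp: indicator_def)
  \<comment> \<open>At most one box contains p, so the sum has at most one nonzero term; it is
    compared with \<open>W\<close> on that box.\<close>
  have pointwise: "(\<Sum>k<n. K * (1 / (\<bar>m\<bar> + real (CARD('d) + k))) * B k p) \<le> W p" for p
  proof (cases "\<exists>k0<n. \<forall>i. p $ i \<in> I k0 i")
    case True
    then obtain k0 where k0: "k0 < n" "\<And>i. p $ i \<in> I k0 i" by blast
    have "p $ i0 \<in> I k i0 \<longleftrightarrow> k = k0" for k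
      using k0(2)[of i0] by (auto simp: I_def)
    then have "B k p = (if k = k0 then 1 else 0)" for k
      unfolding B_eq using k0(2) by auto
    then have "(\<Sum>k<n. K * (1 / (\<bar>m\<bar> + real (CARD('d) + k))) * B k p) =
        1 / (\<bar>m\<bar> + real (CARD('d) + k0)) * K"
      using k0(1) by (simp add: if_distrib[of "\<lambda>x. _ * x"] cong: if_cong)
    also have "\<dots> \<le> W p"
      unfolding W_def
    proof (intro mult_mono inv_sqrt_weight_ge m G_ge)
      \<comment> \<open>The l1 norm counts at most 1 per coordinate and a further k0 along
        \<open>i0\<close>, whence d + k0.\<close>
      have "norm p \<le> (\<Sum>i\<in>UNIV. \<bar>p $ i\<bar>)"
        by (rule norm_le_l1_cart)
      also have "\<dots> \<le> (\<Sum>i\<in>UNIV. 1 + (if i = i0 then real k0 else 0))"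
      proof (rule sum_mono)
        show "\<bar>p $ i\<bar> \<le> 1 + (if i = i0 then real k0 else 0)" for i
          using k0(2)[of i] by (auto simp: I_def split: if_splits)
      qed
      also have "\<dots> = real (CARD('d) + k0)"
        by (simp add: sum.distrib)
      finally show "norm p \<le> real (CARD('d) + k0)" .
      show "\<bar>p $ i\<bar> \<le> real n" for i
        using k0(1) k0(2)[of i] by (auto simp: I_def split: if_splits)
    qed (use K in auto)
    finally show ?thesis .
  next
    case False
    then have "B k p = 0" if "k < n" for k
      using that by (auto simp: B_eq)
    then show ?thesis
      using W_nonneg by simp
  qed
  have int_ind: "integrable lborel (indicator (I k i) :: real \<Rightarrow> real)" for k i
    by (intro integrable_real_indicator) (auto simp: I_def)
  have int_B: "integrable lborel (B k)" for k
    unfolding B_def by (intro integrable_vec_prod int_ind)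
  have integral_B: "(LINT p|lborel. B k p) = 1" for k
    unfolding B_def by (subst integral_vec_prod[OF int_ind]) (auto simp: I_def intro!: prod.neutral)
  have "K * (\<Sum>k<n. 1 / (\<bar>m\<bar> + real (CARD('d) + k))) =
      (LINT p|lborel. (\<Sum>k<n. K * (1 / (\<bar>m\<bar> + real (CARD('d) + k))) * B k p))"
    by (subst Bochner_Integration.integral_sum)
       (auto intro!: integrable_divide integrable_mult_right int_B simp: integral_B sum_distrib_left)
  also have "\<dots> \<le> (LINT p|lborel. W p)"
    using pointwise integrable_weighted_fourier_square[OF m integrable_cell_function integrable_fourier_cell_function, OF h(1) h(1)]
    unfolding W_def G_def
    by (intro integral_mono Bochner_Integration.integrable_sum integrable_mult_right int_B) auto
  finally have "1 / 2 * (1 / (2 * pi) ^ CARD('d)) * (K * (\<Sum>k<n. 1 / (\<bar>m\<bar> + real (CARD('d) + k)))) \<le>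
      1 / 2 * (1 / (2 * pi) ^ CARD('d)) * (LINT p|lborel. W p)"
    by (rule mult_left_mono) simp
  moreover have "covariance m (cell_function a h) (cell_function a h) =
      complex_of_real (1 / 2 * (1 / (2 * pi) ^ CARD('d)) * (LINT p|lborel. W p))"
    unfolding W_def G_def
    by (rule covariance_eq_fourier[OF m integrable_cell_function integrable_fourier_cell_function]) (rule h)+
  ultimately show ?thesis
    unfolding K_def by (intro exI conjI) (auto simp: mult_ac)
qed

subsection \<open>Small ball estimates\<close>

text \<open>The density is at most 1 and the interval has length 2 r.\<close>

lemma std_normal_small_ball:
  assumes "0 \<le> r"
  shows "measure std_normal_distribution {- r..r} \<le> 2 * r"
proof -
  have "std_normal_density x \<le> 1" for x
  proof -
    have "1 / sqrt (2 * pi) * exp (- x\<^sup>2 / 2) \<le> 1 * 1"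
      using pi_gt3 by (intro mult_mono) auto
    then show ?thesis by (simp add: std_normal_density_def)
  qed
  then have "(\<integral>\<^sup>+x. ennreal (std_normal_density x) * indicator {- r..r} x \<partial>lborel) \<le>
      (\<integral>\<^sup>+x. indicator {- r..r} x \<partial>lborel)"
    by (intro nn_integral_mono) (auto simp: indicator_def)
  also have "\<dots> = ennreal (2 * r)"
    using assms by simp
  finally have "emeasure std_normal_distribution {- r..r} \<le> ennreal (2 * r)"
    by (simp add: emeasure_density)
  then show ?thesis
    using assms by (simp add: measure_def enn2real_leI)
qed

text \<open>Levy uniqueness identifies the law of X/\<sigma> as standard normal from its
  characteristic function, the only information that the definition of the field supplies.\<close>

lemma (in prob_space) gaussian_small_ball:
  fixes X :: "'a \<Rightarrow> real"
  assumes [measurable]: "X \<in> borel_measurable M" and "0 < \<sigma>" "0 \<le> r"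
    and chr: "\<And>t. (LINT \<omega>|M. iexp (t * X \<omega>)) = complex_of_real (exp (- (t\<^sup>2 * \<sigma>\<^sup>2) / 2))"
  shows "prob {\<omega> \<in> space M. \<bar>X \<omega>\<bar> \<le> r} \<le> 2 * (r / \<sigma>)"
proof -
  define N where "N = distr M borel (\<lambda>\<omega>. X \<omega> / \<sigma>)"
  have "char N t = char std_normal_distribution t" for t
  proof -
    have "char N t = (LINT \<omega>|M. iexp (t / \<sigma> * X \<omega>))"
      unfolding char_def N_def by (subst integral_distr) auto
    then show ?thesis
      using chr[of "t / \<sigma>"] \<open>0 < \<sigma>\<close>
      by (simp add: char_std_normal_distribution power_divide)
  qed
  then have N: "N = std_normal_distribution"
    unfolding N_def
    by (intro Levy_uniqueness real_distribution_distr real_dist_normal_dist ext) auto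
  have "{\<omega> \<in> space M. \<bar>X \<omega>\<bar> \<le> r} = (\<lambda>\<omega>. X \<omega> / \<sigma>) -` {- (r / \<sigma>)..r / \<sigma>} \<inter> space M"
    using \<open>0 < \<sigma>\<close> by (auto simp: field_simps abs_le_iff)
  then have "prob {\<omega> \<in> space M. \<bar>X \<omega>\<bar> \<le> r} = measure N {- (r / \<sigma>)..r / \<sigma>}"
    unfolding N_def by (subst measure_distr) auto
  then show ?thesis
    unfolding N using assms std_normal_small_ball[of "r / \<sigma>"] by simp
qed

text \<open>If the average of the \<open>|X j|\<close> is at most \<open>C / N\<close>, then at least half of them are at most
  \<open>2 C / N\<close>; Markov's inequality for the number of these bounds the probability without any
  independence.\<close>

lemma (in prob_space) prob_sum_abs_le:
  fixes X :: "'i \<Rightarrow> 'a \<Rightarrow> real"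
  assumes J: "finite J" "J \<noteq> {}" and [measurable]: "\<And>j. j \<in> J \<Longrightarrow> X j \<in> borel_measurable M"
    and C: "0 < C"
    and b: "\<And>j. j \<in> J \<Longrightarrow> prob {\<omega> \<in> space M. \<bar>X j \<omega>\<bar> \<le> 2 * C / card J} \<le> b"
  shows "prob {\<omega> \<in> space M. (\<Sum>j\<in>J. \<bar>X j \<omega>\<bar>) \<le> C} \<le> 2 * b"
proof -
  define N where "N = real (card J)"
  have N: "N > 0" using J by (simp add: N_def card_gt_0_iff)
  define A where "A = {\<omega> \<in> space M. (\<Sum>j\<in>J. \<bar>X j \<omega>\<bar>) \<le> C}"
  define B where "B j = {\<omega> \<in> space M. \<bar>X j \<omega>\<bar> \<le> 2 * C / N}" for j
  have [measurable]: "A \<in> events" "\<And>j. j \<in> J \<Longrightarrow> B j \<in> events"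
    unfolding A_def B_def by measurable
  have pointwise: "N / 2 * indicator A \<omega> \<le> (\<Sum>j\<in>J. indicator (B j) \<omega> :: real)" for \<omega>
  proof (cases "\<omega> \<in> A")
    case True
    \<comment> \<open>Each j outside its small ball contributes more than 2 C / N, so a total of at
      most C leaves room for at most N/2 such j.\<close>
    have "(\<Sum>j\<in>J. 2 * C / N * (1 - indicator (B j) \<omega>)) \<le> (\<Sum>j\<in>J. \<bar>X j \<omega>\<bar>)"
    proof (rule sum_mono)
      show "2 * C / N * (1 - indicator (B j) \<omega>) \<le> \<bar>X j \<omega>\<bar>" for j
        using True by (auto simp: indicator_def B_def A_def)
    qed
    also have "\<dots> \<le> C" using True by (simp add: A_def)
    also have "(\<Sum>j\<in>J. 2 * C / N * (1 - indicator (B j) \<omega>)) =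
        2 * C / N * (N - (\<Sum>j\<in>J. indicator (B j) \<omega>))"
      by (simp only: sum_distrib_left[symmetric] sum_subtractf) (simp add: N_def)
    finally have "2 * (N - (\<Sum>j\<in>J. indicator (B j) \<omega>)) \<le> N"
      using C N by (simp add: field_simps)
    then show ?thesis using True by simp
  qed (simp add: sum_nonneg)
  have "N / 2 * prob A = (LINT \<omega>|M. N / 2 * indicator A \<omega>)"
    by simp
  also have "\<dots> \<le> (LINT \<omega>|M. (\<Sum>j\<in>J. indicator (B j) \<omega>))"
    using pointwise by (intro integral_mono) (auto simp: emeasure_eq_measure)
  also have "\<dots> = (\<Sum>j\<in>J. prob (B j))"
    by (subst Bochner_Integration.integral_sum) (auto simp: emeasure_eq_measure)
  also have "\<dots> \<le> (\<Sum>j\<in>J. b)"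
    using b by (intro sum_mono) (simp add: B_def N_def)
  also have "\<dots> = N * b" by (simp add: N_def)
  finally have "prob A \<le> 2 * b"
    using N by (simp add: field_simps)
  then show ?thesis by (simp add: A_def)
qed

text \<open>For k >= 1, A + k <= (A + 1) k, so a bound would make the harmonic series
  converge.\<close>

lemma shifted_harmonic_unbounded:
  fixes A :: real
  assumes "0 < A"
  shows "\<exists>n. x < (\<Sum>k<n. 1 / (A + real k))"
proof (rule ccontr)
  assume "\<not> ?thesis"
  then have "summable (\<lambda>k. 1 / (A + real k))"
    using assms by (intro summableI_nonneg_bounded[of _ x]) (auto simp: not_less)
  then have "summable (\<lambda>k. (A + 1) * (1 / (A + real k)))"
    by (rule summable_mult)
  moreover have "norm (inverse (real k)) \<le> (A + 1) * (1 / (A + real k))" if "1 \<le> k" for k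
  proof -
    have "A * 1 \<le> A * real k"
      using that assms by (intro mult_left_mono) auto
    then have "A + real k \<le> (A + 1) * real k"
      by (simp add: algebra_simps)
    then show ?thesis
      using that assms by (simp add: field_simps)
  qed
  ultimately have "summable (\<lambda>k. inverse (real k))"
    by (rule summable_comparison_test'[where N = 1])
  then show False
    using not_summable_harmonic by blast
qed

subsection \<open>Bumps on the cells of a cube\<close>

definition cells :: "nat \<Rightarrow> ('d::finite \<Rightarrow> nat) set" where
  "cells n = PiE UNIV (\<lambda>_. {..<n})"

definition cell_test :: "real^'d::finite \<Rightarrow> real \<Rightarrow> nat \<Rightarrow> ('d \<Rightarrow> nat) \<Rightarrow> real^'d \<Rightarrow> real" where
  "cell_test a L n j = cell_function (\<lambda>i. a $ i + real (j i) * (L / real n)) (L / real n)"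

lemma finite_cells: "finite (cells n :: ('d::finite \<Rightarrow> nat) set)"
  unfolding cells_def by (intro finite_PiE) auto

lemma card_cells: "card (cells n :: ('d::finite \<Rightarrow> nat) set) = n ^ CARD('d)"
  unfolding cells_def by (subst card_PiE) auto

lemma cell_test_nonneg: "0 \<le> cell_test a L n j x"
  unfolding cell_test_def prod_bump_def by (intro prod_nonneg) (simp add: cell_bump_nonneg)

text \<open>The open intervals are disjoint, so at most one term is nonzero, and it is at most
  1.\<close>

lemma sum_cell_bump_le_1:
  assumes h: "0 < h"
  shows "(\<Sum>k<n. cell_bump (a + real k * h) h t) \<le> 1"
proof (cases "\<exists>k0<n. t \<in> {a + real k0 * h<..<a + real k0 * h + h}")
  case True
  then obtain k0 where k0: "k0 < n" "t \<in> {a + real k0 * h<..<a + real k0 * h + h}" by blast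
  have "cell_bump (a + real k * h) h t = 0" if "k \<noteq> k0" for k
  proof (rule bump_ivl_eq_0[OF h], rule notI)
    assume t: "t \<in> {a + real k * h<..<a + real k * h + h}"
    then have "real k * h < (real k0 + 1) * h" "real k0 * h < (real k + 1) * h"
      using k0(2) by (auto simp: algebra_simps)
    then have "real k < real k0 + 1" "real k0 < real k + 1"
      using h by simp_all
    then show False using that by linarith
  qed
  then have "(\<Sum>k<n. cell_bump (a + real k * h) h t) = (\<Sum>k\<in>{k0}. cell_bump (a + real k * h) h t)"
    using k0(1) by (intro sum.mono_neutral_right) auto
  then show ?thesis using cell_bump_le_1 by simp
next
  case False
  then have "cell_bump (a + real k * h) h t = 0" if "k < n" for k
    using that by (intro bump_ivl_eq_0[OF h]) blast
  then show ?thesis by simp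
qed

text \<open>The sum over multi-indices of a product factors into a product of one-dimensional
  sums.\<close>

lemma sum_cell_test_le_1:
  assumes "0 < L" "0 < n"
  shows "(\<Sum>j\<in>cells n. cell_test a L n j x) \<le> 1"
proof -
  have "(\<Sum>j\<in>cells n. cell_test a L n j x) =
      (\<Prod>i\<in>UNIV. \<Sum>k<n. cell_bump (a $ i + real k * (L / real n)) (L / real n) (x $ i))"
    unfolding cells_def cell_test_def prod_bump_def by (subst prod_sum_PiE) auto
  also have "\<dots> \<le> (\<Prod>i\<in>(UNIV::'a set). 1)"
    using assms by (intro prod_mono conjI sum_nonneg sum_cell_bump_le_1) (auto simp: cell_bump_nonneg)
  finally show ?thesis by simp
qed

lemma cell_test_support:
  fixes a :: "real^'d::finite"
  assumes L: "0 < L" and n: "0 < n" and j: "j \<in> cells n" and U: "cbox a (a + (\<chi> i. L)) \<subseteq> U"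
  shows "supported_in (cell_test a L n j) U"
proof -
  let ?h = "L / real n"
  have "{x. cell_test a L n j x \<noteq> 0} \<subseteq> cbox a (a + (\<chi> i. L))"
  proof
    fix x assume "x \<in> {x. cell_test a L n j x \<noteq> 0}"
    then have *: "cell_bump (a $ i + real (j i) * ?h) ?h (x $ i) \<noteq> 0" for i
      by (auto simp: cell_test_def prod_bump_def)
    have "a $ i \<le> x $ i \<and> x $ i \<le> a $ i + L" for i
    proof -
      have x: "x $ i \<in> {a $ i + real (j i) * ?h<..<a $ i + real (j i) * ?h + ?h}"
        using bump_ivl_eq_0[of ?h "x $ i"] * L n by auto
      have "j i < n"
        using j by (auto simp: cells_def PiE_iff)
      then have "real (j i) + 1 \<le> real n"
        by linarith
      then have "(real (j i) + 1) * ?h \<le> real n * ?h"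
        using L by (intro mult_right_mono) auto
      then have "real (j i) * ?h + ?h \<le> L"
        using n by (simp only: distrib_right mult_1) simp
      moreover have "real (j i) * ?h \<ge> 0" using L by simp
      ultimately show ?thesis using x by auto
    qed
    then show "x \<in> cbox a (a + (\<chi> i. L))"
      by (simp add: mem_box_cart)
  qed
  then have "closure {x. cell_test a L n j x \<noteq> 0} \<subseteq> cbox a (a + (\<chi> i. L))"
    by (rule closure_minimal) (rule closed_cbox)
  then show ?thesis
    using U by (auto simp: supported_in_def)
qed

lemma cell_test_schwartz:
  "0 < L \<Longrightarrow> 0 < n \<Longrightarrow> (\<lambda>x. s * cell_test a L n j x) \<in> schwartz"
  unfolding cell_test_def by (intro scaled_prod_bump_schwartz) simp

text \<open>The constant is the total variation, the integral of |F|. Since the bumps sum to at most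
  1 pointwise, the same constant serves every n.\<close>

lemma signed_measure_cell_sums_bounded:
  fixes a :: "real^'d::finite"
  assumes L: "0 < L" and U: "cbox a (a + (\<chi> i. L)) \<subseteq> U" and \<phi>: "signed_measure_on U \<phi>"
  shows "\<exists>C. \<forall>n>0. (\<Sum>j\<in>cells n. \<bar>\<phi> (cell_test a L n j)\<bar>) \<le> C"
proof -
  obtain \<nu> F where sets: "sets \<nu> = sets (restrict_space borel U)" and F: "integrable \<nu> F"
    and eq: "\<And>f. f \<in> schwartz \<Longrightarrow> supported_in f U \<Longrightarrow> \<phi> f = (LINT x|\<nu>. f x * F x)"
    using \<phi> unfolding signed_measure_on_def by blast
  have [measurable]: "F \<in> borel_measurable \<nu>" using F by simp
  have "(\<Sum>j\<in>cells n. \<bar>\<phi> (cell_test a L n j)\<bar>) \<le> (LINT x|\<nu>. \<bar>F x\<bar>)" if n: "0 < n" for n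
  proof -
    define f where "f = cell_test a L n"
    have f0: "0 \<le> f j x" for j x by (simp add: f_def cell_test_nonneg)
    have f1: "(\<Sum>j\<in>cells n. f j x) \<le> 1" for x
      unfolding f_def by (rule sum_cell_test_le_1[OF L n])
    have fle: "f j x \<le> 1" if "j \<in> cells n" for j x
      using member_le_sum[OF that, of "\<lambda>j. f j x"] f0 f1[of x] finite_cells[of n] by force
    have [measurable]: "f j \<in> borel_measurable \<nu>" for j
    proof -
      have "f j \<in> borel_measurable borel"
        unfolding f_def cell_test_def by measurable
      then have "f j \<in> borel_measurable (restrict_space borel U)"
        by (rule measurable_restrict_space1)
      then show ?thesis
        using measurable_cong_sets[OF sets refl] by blast
    qed
    have int: "integrable \<nu> (\<lambda>x. f j x * \<bar>F x\<bar>)" "integrable \<nu> (\<lambda>x. f j x * F x)"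
      if "j \<in> cells n" for j
    proof -
      have "f j x * \<bar>F x\<bar> \<le> \<bar>F x\<bar>" for x
        using mult_right_mono[OF fle[OF that, of x], of "\<bar>F x\<bar>"] by simp
      then show "integrable \<nu> (\<lambda>x. f j x * \<bar>F x\<bar>)" "integrable \<nu> (\<lambda>x. f j x * F x)"
        using f0 by (auto intro!: Bochner_Integration.integrable_bound[OF F] simp: abs_mult)
    qed
    have "(\<Sum>j\<in>cells n. \<bar>\<phi> (f j)\<bar>) \<le> (\<Sum>j\<in>cells n. (LINT x|\<nu>. f j x * \<bar>F x\<bar>))"
    proof (rule sum_mono)
      fix j :: "'d \<Rightarrow> nat" assume j: "j \<in> cells n"
      have "\<phi> (f j) = (LINT x|\<nu>. f j x * F x)"
        using cell_test_schwartz[OF L n, of 1 a j] cell_test_support[OF L n j U]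
        by (intro eq) (auto simp: f_def)
      also have "\<bar>\<dots>\<bar> \<le> (LINT x|\<nu>. \<bar>f j x * F x\<bar>)"
        by (rule integral_abs_bound)
      finally show "\<bar>\<phi> (f j)\<bar> \<le> (LINT x|\<nu>. f j x * \<bar>F x\<bar>)"
        using f0 by (simp add: abs_mult)
    qed
    also have "\<dots> = (LINT x|\<nu>. (\<Sum>j\<in>cells n. f j x * \<bar>F x\<bar>))"
      using int by (subst Bochner_Integration.integral_sum) auto
    also have "\<dots> \<le> (LINT x|\<nu>. \<bar>F x\<bar>)"
    proof (intro integral_mono Bochner_Integration.integrable_sum int integrable_abs F)
      show "(\<Sum>j\<in>cells n. f j x * \<bar>F x\<bar>) \<le> \<bar>F x\<bar>" for x
        using mult_right_mono[OF f1[of x], of "\<bar>F x\<bar>"] by (simp add: sum_distrib_right)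
    qed
    finally show ?thesis by (simp add: f_def)
  qed
  then show ?thesis by blast
qed

section \<open>The Gaussian field evaluated on the cells\<close>

lemma measurable_evaluation:
  assumes "sets \<mu> = sets cylinder_algebra" "f \<in> schwartz"
  shows "(\<lambda>\<phi>. \<phi> f) \<in> borel_measurable \<mu>"
proof -
  have "{\<phi> \<in> tempered_distributions. \<phi> f \<in> B} \<in> sets cylinder_algebra" if "B \<in> sets borel" for B
    unfolding cylinder_algebra_def using assms(2) that by (intro in_measure_of) auto
  moreover have "space \<mu> = tempered_distributions"
    using sets_eq_imp_space_eq[OF assms(1)] by (simp add: cylinder_algebra_def space_measure_of_conv)
  ultimately show ?thesis
    using assms(1) by (intro measurableI) (auto simp: vimage_def Int_def conj_commute)
qed

text \<open>The defining identity is applied to t f; linearity of \<phi> takes t out on the left and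
  quadratic scaling of the covariance takes it out on the right.\<close>

lemma gaussian_measure_char:
  assumes \<mu>: "gaussian_measure m \<mu>" and f: "\<And>s. (\<lambda>x. s * f x) \<in> schwartz"
    and v: "covariance m f f = complex_of_real v"
  shows "(LINT \<phi>|\<mu>. iexp (t * \<phi> f)) = complex_of_real (exp (- (t\<^sup>2 * v) / 2))"
proof -
  have "space \<mu> = tempered_distributions"
    using \<mu> sets_eq_imp_space_eq[of \<mu> cylinder_algebra]
    by (simp add: gaussian_measure_def cylinder_algebra_def space_measure_of_conv)
  then have lin: "\<phi> (\<lambda>x. t * f x) = t * \<phi> f" if "\<phi> \<in> space \<mu>" for \<phi>
  proof -
    have "f \<in> schwartz" using f[of 1] by simp
    then have "\<phi> (\<lambda>x. t * f x + 0 * f x) = t * \<phi> f + 0 * \<phi> f"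
      using that \<open>space \<mu> = tempered_distributions\<close> unfolding tempered_distributions_def by blast
    then show ?thesis by simp
  qed
  have "(LINT \<phi>|\<mu>. iexp (t * \<phi> f)) = (LINT \<phi>|\<mu>. iexp (\<phi> (\<lambda>x. t * f x)))"
    using lin by (intro Bochner_Integration.integral_cong) auto
  also have "\<dots> = exp (- 1 / 2 * covariance m (\<lambda>x. t * f x) (\<lambda>x. t * f x))"
    using \<mu> f[of t] unfolding gaussian_measure_def by blast
  also have "\<dots> = complex_of_real (exp (- (t\<^sup>2 * v) / 2))"
    unfolding covariance_scale v by (simp add: exp_of_real[symmetric] field_simps)
  finally show ?thesis .
qed

text \<open>The small-ball bound with radius 2 C / N and variance v gives 4 C / (N sqrt v) per cell;
  the counting argument doubles it to the constant 8.\<close>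

lemma prob_cell_sum_le:
  fixes a :: "real^'d::finite"
  assumes m: "m \<noteq> 0" and \<mu>: "gaussian_measure m \<mu>" and L: "0 < L" "L \<le> 1" and C: "0 < C" and n: "0 < n"
  defines "\<kappa> \<equiv> 1 / 2 * (1 / (2 * pi) ^ CARD('d)) * (exp (- 8) / 4 * L) ^ (2 * CARD('d))"
  shows "measure \<mu> {\<phi> \<in> space \<mu>. (\<Sum>j\<in>cells n. \<bar>\<phi> (cell_test a L n j)\<bar>) \<le> C} \<le>
    8 * C / sqrt (\<kappa> * (\<Sum>k<n. 1 / (\<bar>m\<bar> + real (CARD('d) + k))))"
proof -
  interpret prob_space \<mu> using \<mu> by (simp add: gaussian_measure_def)
  define S where "S = (\<Sum>k<n. 1 / (\<bar>m\<bar> + real (CARD('d) + k)))"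
  have S: "S > 0"
    unfolding S_def using n m by (intro sum_pos) (auto intro!: divide_pos_pos add_nonneg_pos add_pos_nonneg)
  have \<kappa>: "\<kappa> > 0"
    unfolding \<kappa>_def using L by (intro mult_pos_pos zero_less_power) auto
  define N where "N = real (card (cells n :: ('d \<Rightarrow> nat) set))"
  have N: "N = real n ^ CARD('d)" "N > 0"
    using n by (simp_all add: N_def card_cells)
  have sch: "(\<lambda>x. s * cell_test a L n j x) \<in> schwartz" for s j
    by (rule cell_test_schwartz[OF L(1) n])
  then have [measurable]: "(\<lambda>\<phi>. \<phi> (cell_test a L n j)) \<in> borel_measurable \<mu>" for j
    using \<mu> sch[of 1] by (intro measurable_evaluation) (auto simp: gaussian_measure_def)
  have "prob {\<phi> \<in> space \<mu>. \<bar>\<phi> (cell_test a L n j)\<bar> \<le> 2 * C / N} \<le> 4 * C / sqrt (\<kappa> * S)" for j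
  proof -
    obtain v where v: "covariance m (cell_test a L n j) (cell_test a L n j) = complex_of_real v"
      "v \<ge> 1 / 2 * (1 / (2 * pi) ^ CARD('d)) * (exp (- 8) / 4 * (L / real n)) ^ (2 * CARD('d)) * S"
      \<comment> \<open>Here n cells of width L/n have total length L <= 1, as the low-frequency
        condition requires.\<close>
      using covariance_cell_function[OF m, of "L / real n" n "\<lambda>i. a $ i + real (j i) * (L / real n)"] L n
      unfolding cell_test_def S_def by auto
    \<comment> \<open>The factor n^(-2d) from the cell width cancels N^2 exactly, in every
      dimension; only the divergent sum \<open>S\<close> still depends on n.\<close>
    have "N\<^sup>2 * (1 / 2 * (1 / (2 * pi) ^ CARD('d)) * (exp (- 8) / 4 * (L / real n)) ^ (2 * CARD('d)) * S) = \<kappa> * S"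
      unfolding \<kappa>_def N(1) using n by (simp add: power_divide power_mult_distrib power_mult field_simps)
    then have Nv: "\<kappa> * S \<le> N\<^sup>2 * v"
      using mult_left_mono[OF v(2), of "N\<^sup>2"] by simp
    then have "N\<^sup>2 * v > 0"
      using \<kappa> S mult_pos_pos[OF \<kappa> S] by linarith
    then have "v > 0"
      by (simp add: zero_less_mult_iff)
    have "prob {\<phi> \<in> space \<mu>. \<bar>\<phi> (cell_test a L n j)\<bar> \<le> 2 * C / N} \<le> 2 * (2 * C / N / sqrt v)"
      using gaussian_measure_char[OF \<mu> sch v(1)] \<open>v > 0\<close> C N(2)
      by (intro gaussian_small_ball) auto
    also have "\<dots> = 4 * C / sqrt (N\<^sup>2 * v)"
      using N(2) by (simp add: real_sqrt_mult)
    also have "\<dots> \<le> 4 * C / sqrt (\<kappa> * S)"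
      using Nv C mult_pos_pos[OF \<kappa> S] by (intro divide_left_mono mult_pos_pos) auto
    finally show ?thesis .
  qed
  then have "prob {\<phi> \<in> space \<mu>. (\<Sum>j\<in>cells n. \<bar>\<phi> (cell_test a L n j)\<bar>) \<le> C} \<le> 2 * (4 * C / sqrt (\<kappa> * S))"
    using C N(2) finite_cells unfolding N_def by (intro prob_sum_abs_le) auto
  then show ?thesis by (simp add: S_def)
qed

text \<open>For a fixed bound the probability is controlled at each single n by a quantity tending
  to 0, so the event for all n is null. Countably many integer bounds exhaust all
  \<open>C\<close>.\<close>

lemma AE_cell_sums_unbounded:
  fixes a :: "real^'d::finite"
  assumes m: "m \<noteq> 0" and \<mu>: "gaussian_measure m \<mu>" and L: "0 < L" "L \<le> 1"
  shows "AE \<phi> in \<mu>. \<not> (\<exists>C. \<forall>n>0. (\<Sum>j\<in>cells n. \<bar>\<phi> (cell_test a L n j)\<bar>) \<le> C)"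
proof -
  interpret prob_space \<mu> using \<mu> by (simp add: gaussian_measure_def)
  define T where "T n \<phi> = (\<Sum>j\<in>cells n. \<bar>\<phi> (cell_test a L n j)\<bar>)" for n and \<phi> :: "(real^'d \<Rightarrow> real) \<Rightarrow> real"
  define \<kappa> where "\<kappa> = 1 / 2 * (1 / (2 * pi) ^ CARD('d)) * (exp (- 8) / 4 * L) ^ (2 * CARD('d))"
  have \<kappa>: "\<kappa> > 0"
    unfolding \<kappa>_def using L by (intro mult_pos_pos zero_less_power) auto
  have [measurable]: "T n \<in> borel_measurable \<mu>" if "0 < n" for n
    unfolding T_def using \<mu> cell_test_schwartz[OF L(1) that, of 1]
    by (intro borel_measurable_sum borel_measurable_abs measurable_evaluation) (auto simp: gaussian_measure_def)
  \<comment> \<open>\<open>Suc c\<close> keeps the bound positive, as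
    \<open>prob_cell_sum_le\<close> demands.\<close>
  have "AE \<phi> in \<mu>. \<not> (\<forall>n\<in>{0<..}. T n \<phi> \<le> real (Suc c))" for c
  proof -
    define E where "E = {\<phi> \<in> space \<mu>. \<forall>n\<in>{0<..}. T n \<phi> \<le> real (Suc c)}"
    have [measurable]: "E \<in> events"
    proof -
      \<comment> \<open>The condition is vacuous at n = 0, so each set in the countable intersection
        is an event.\<close>
      have "{\<phi> \<in> space \<mu>. n \<in> {0<..} \<longrightarrow> T n \<phi> \<le> real (Suc c)} \<in> events" for n
        by (cases "n = 0") auto
      then show ?thesis
        unfolding E_def Ball_def by (rule sets.sets_Collect_countable_All)
    qed
    have "prob E \<le> 0 + e" if "0 < e" for e
    proof -
      \<comment> \<open>This n makes sqrt (\<kappa> S) exceed 8 (c + 1) / e, which turns the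
        probability bound into e.\<close>
      obtain n where n: "(8 * real (Suc c) / e)\<^sup>2 / \<kappa> < (\<Sum>k<n. 1 / (\<bar>m\<bar> + real CARD('d) + real k))"
        using shifted_harmonic_unbounded[of "\<bar>m\<bar> + real CARD('d)"] m by (auto simp: add_pos_nonneg)
      define S where "S = (\<Sum>k<n. 1 / (\<bar>m\<bar> + real (CARD('d) + k)))"
      have S: "(8 * real (Suc c) / e)\<^sup>2 / \<kappa> < S"
        using n by (simp add: S_def add.assoc)
      have "n \<noteq> 0"
      proof
        assume "n = 0"
        then have "(8 * real (Suc c) / e)\<^sup>2 / \<kappa> < 0"
          using S by (simp add: S_def)
        then show False using \<kappa> by (simp add: divide_less_0_iff)
      qed
      have "(8 * real (Suc c) / e)\<^sup>2 < \<kappa> * S"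
        using S \<kappa> by (simp only: pos_divide_less_eq mult.commute)
      then have *: "8 * real (Suc c) / e < sqrt (\<kappa> * S)"
        by (rule real_less_rsqrt)
      moreover have "0 < 8 * real (Suc c) / e"
        using \<open>0 < e\<close> by simp
      ultimately have pos: "0 < sqrt (\<kappa> * S)"
        by linarith
      have "prob E \<le> prob {\<phi> \<in> space \<mu>. T n \<phi> \<le> real (Suc c)}"
        using \<open>n \<noteq> 0\<close> by (intro finite_measure_mono) (auto simp: E_def)
      also have "\<dots> \<le> 8 * real (Suc c) / sqrt (\<kappa> * S)"
        using prob_cell_sum_le[OF m \<mu> L, of "real (Suc c)" n a] \<open>n \<noteq> 0\<close>
        unfolding T_def S_def \<kappa>_def by simp
      also have "\<dots> \<le> e"
        using * pos \<open>0 < e\<close> by (simp add: field_simps)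
      finally show ?thesis by simp
    qed
    then have "prob E \<le> 0" by (rule field_le_epsilon)
    then have "prob E = 0" by (simp add: measure_le_0_iff)
    then have "AE \<phi> in \<mu>. \<phi> \<notin> E"
      by (subst (asm) prob_eq_0) auto
    then show ?thesis
      using AE_space by eventually_elim (auto simp: E_def)
  qed
  then have "AE \<phi> in \<mu>. \<forall>c. \<not> (\<forall>n\<in>{0<..}. T n \<phi> \<le> real (Suc c))"
    by (simp add: AE_all_countable)
  then show ?thesis
  proof eventually_elim
    case (elim \<phi>)
    show ?case
    proof
      assume "\<exists>C. \<forall>n>0. (\<Sum>j\<in>cells n. \<bar>\<phi> (cell_test a L n j)\<bar>) \<le> C"
      then obtain C where C: "\<And>n. n > 0 \<Longrightarrow> T n \<phi> \<le> C"
        by (auto simp: T_def)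
      obtain c where "C \<le> real c"
        using real_arch_simple by blast
      then have "T n \<phi> \<le> real (Suc c)" if "n > 0" for n
        using C[OF that] by simp
      then show False using elim by auto
    qed
  qed
qed

theorem mainTheorem2:
  fixes m :: real and \<mu> :: "((real^'d::finite \<Rightarrow> real) \<Rightarrow> real) measure"
  assumes "m \<noteq> 0" and "gaussian_measure m \<mu>"
  shows "AE \<phi> in \<mu>. \<not> (\<exists>U. open U \<and> U \<noteq> {} \<and> signed_measure_on U \<phi>)"
proof -
  \<comment> \<open>Corners in a countable dense set and sides 1/(r + 1) give countably many cubes,
    whose null sets unite to one null set. Each non-empty open set contains one of these
    cubes.\<close>
  obtain D :: "(real^'d) set" where D: "countable D" "\<And>X. open X \<Longrightarrow> X \<noteq> {} \<Longrightarrow> \<exists>d\<in>D. d \<in> X"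
    by (rule countable_dense_setE) (rule that)
  have "AE \<phi> in \<mu>. \<not> (\<exists>C. \<forall>n>0. (\<Sum>j\<in>cells n. \<bar>\<phi> (cell_test a (1 / real (Suc r)) n j)\<bar>) \<le> C)" for a r
    by (rule AE_cell_sums_unbounded[OF assms]) auto
  then have "AE \<phi> in \<mu>. \<forall>a\<in>D. \<forall>r. \<not> (\<exists>C. \<forall>n>0. (\<Sum>j\<in>cells n. \<bar>\<phi> (cell_test a (1 / real (Suc r)) n j)\<bar>) \<le> C)"
    using D(1) by (simp add: AE_ball_countable AE_all_countable)
  then show ?thesis
  proof eventually_elim
    case (elim \<phi>)
    show ?case
    proof
      assume "\<exists>U. open U \<and> U \<noteq> {} \<and> signed_measure_on U \<phi>"
      then obtain U where U: "open U" "U \<noteq> {}" "signed_measure_on U \<phi>" by blast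
      obtain a where a: "a \<in> D" "a \<in> U" using D(2)[OF U(1,2)] by blast
      obtain e where e: "0 < e" "ball a e \<subseteq> U"
        using U(1) a(2) open_contains_ball by blast
      \<comment> \<open>Points of the cube lie within l1 distance d L of its corner, so a side below
        e/d keeps the cube inside the ball.\<close>
      obtain r where r: "1 / real (Suc r) < e / real CARD('d)"
        using nat_approx_posE[of "e / real CARD('d)"] e(1) by auto
      define L where "L = 1 / real (Suc r)"
      have "cbox a (a + (\<chi> i. L)) \<subseteq> ball a e"
      proof
        fix x assume x: "x \<in> cbox a (a + (\<chi> i. L))"
        have "norm (x - a) \<le> (\<Sum>i\<in>UNIV. \<bar>(x - a) $ i\<bar>)"
          by (rule norm_le_l1_cart)
        also have "\<dots> \<le> (\<Sum>i\<in>(UNIV::'d set). L)"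
        proof (rule sum_mono)
          show "\<bar>(x - a) $ i\<bar> \<le> L" for i
            using x by (auto simp: mem_box_cart abs_le_iff algebra_simps dest!: spec[of _ i])
        qed
        also have "\<dots> = real CARD('d) * L" by simp
        also have "\<dots> < e"
          using r by (simp add: L_def field_simps)
        finally show "x \<in> ball a e"
          by (simp add: dist_norm norm_minus_commute)
      qed
      then have "cbox a (a + (\<chi> i. L)) \<subseteq> U" using e(2) by blast
      then have "\<exists>C. \<forall>n>0. (\<Sum>j\<in>cells n. \<bar>\<phi> (cell_test a L n j)\<bar>) \<le> C"
        using U(3) by (intro signed_measure_cell_sums_bounded) (auto simp: L_def)
      then show False
        using elim a(1) by (auto simp: L_def)
    qed
  qed
qed

end
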